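(* For every function $f: \mathbb{N}_+ \rightarrow \mathbb{N}_+$ there exists a finitely generated residually finite group $G$ with FAb such that $ab_n(G) \geq f(n)$ for infinitely many $n$. Likewise, for every function $f: \mathbb{N}_+ \rightarrow \mathbb{N}_+$ there exists a finitely generated residually finite group $G$ with FAb such that $Rep_n(G) \geq f(n)$ for infinitely many $n$.
   Context: For a group $G$ and an integer $n\ge 1$, $ab_n(G) := \sup\{\, |H/H'| : H \leqslant G,\ |G:H| \leq n \,\}$, where $H'=[H,H]$. $Rep_n(G)$ is the number of pairwise inequivalent irreducible complex representations of $G$ of degree at most $n$ with finite image. A group $G$ has FAb (Finite Abelianizations) if $|H/H'|$ is finite for every subgroup $H \leqslant G$ of finite index. $\mathbb{N}_+$ is the set of positive integers. *)

theory Defs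
  imports
    "HOL-Algebra.Generated_Groups"
    "HOL-Library.Extended_Nat"
    "Jordan_Normal_Form.VS_Connect"
begin

section \<open>Finite index, residual finiteness and FAb\<close>

text \<open>Cardinality as an extended natural number, so that an infinite set is not given
  cardinality \<open>0\<close>.\<close>

definition ecard :: "'a set \<Rightarrow> enat" where
  "ecard A = (if finite A then enat (card A) else \<infinity>)"

definition finitely_generated :: "('a, 'b) monoid_scheme \<Rightarrow> bool" where
  "finitely_generated G \<longleftrightarrow> (\<exists>S. finite S \<and> S \<subseteq> carrier G \<and> generate G S = carrier G)"

definition finite_index :: "'a set \<Rightarrow> ('a, 'b) monoid_scheme \<Rightarrow> bool" where
  "finite_index H G \<longleftrightarrow> subgroup H G \<and> finite (rcosets\<^bsub>G\<^esub> H)"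

definition residually_finite :: "('a, 'b) monoid_scheme \<Rightarrow> bool" where
  "residually_finite G \<longleftrightarrow>
     (\<forall>g \<in> carrier G. g \<noteq> \<one>\<^bsub>G\<^esub> \<longrightarrow> (\<exists>N. N \<lhd> G \<and> finite_index N G \<and> g \<notin> N))"

definition abelianization :: "'a set \<Rightarrow> ('a, 'b) monoid_scheme \<Rightarrow> 'a set monoid" where
  "abelianization H G = (G\<lparr>carrier := H\<rparr>) Mod (derived G H)"

definition FAb :: "('a, 'b) monoid_scheme \<Rightarrow> bool" where
  "FAb G \<longleftrightarrow> (\<forall>H. finite_index H G \<longrightarrow> finite (carrier (abelianization H G)))"

definition ab :: "nat \<Rightarrow> ('a, 'b) monoid_scheme \<Rightarrow> enat" where
  "ab n G =
     (SUP H \<in> {H. subgroup H G \<and> ecard (rcosets\<^bsub>G\<^esub> H) \<le> enat n}.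
        ecard (carrier (abelianization H G)))"


section \<open>Complex representations\<close>

definition GL :: "nat \<Rightarrow> complex mat monoid" where
  "GL d = units_of (ring_mat TYPE(complex) d ())"

definition irreducible_rep ::
  "('a, 'b) monoid_scheme \<Rightarrow> nat \<Rightarrow> ('a \<Rightarrow> complex mat) \<Rightarrow> bool" where
  "irreducible_rep G d \<rho> \<longleftrightarrow>
     \<rho> \<in> hom G (GL d) \<and> d \<ge> 1 \<and>
     (\<forall>W. VectorSpace.subspace class_ring W (module_vec TYPE(complex) d) \<and>
          (\<forall>g \<in> carrier G. \<forall>w \<in> W. \<rho> g *\<^sub>v w \<in> W)
        \<longrightarrow> W = {0\<^sub>v d} \<or> W = carrier_vec d)"

definition equivalent_rep ::
  "('a, 'b) monoid_scheme \<Rightarrow> nat \<Rightarrow> ('a \<Rightarrow> complex mat) \<Rightarrow> ('a \<Rightarrow> complex mat) \<Rightarrow> bool" where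
  "equivalent_rep G d \<rho> \<sigma> \<longleftrightarrow>
     (\<exists>P \<in> carrier (GL d). \<forall>g \<in> carrier G. P * \<rho> g = \<sigma> g * P)"

text \<open>A representation is stored together with its degree; representations of different
  degrees are inequivalent. Elements of \<open>hom\<close> are unconstrained outside the
  carrier, but such variants of one representation are equivalent and hence fall into
  one class.\<close>

definition finite_image_irreps ::
  "nat \<Rightarrow> ('a, 'b) monoid_scheme \<Rightarrow> (nat \<times> ('a \<Rightarrow> complex mat)) set" where
  "finite_image_irreps n G =
     {(d, \<rho>). d \<le> n \<and> irreducible_rep G d \<rho> \<and> finite (\<rho> ` carrier G)}"

definition rep_equivalence ::
  "nat \<Rightarrow> ('a, 'b) monoid_scheme \<Rightarrow>
     ((nat \<times> ('a \<Rightarrow> complex mat)) \<times> (nat \<times> ('a \<Rightarrow> complex mat))) set" where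
  "rep_equivalence n G =
     {((d, \<rho>), (e, \<sigma>)). (d, \<rho>) \<in> finite_image_irreps n G \<and>
        (e, \<sigma>) \<in> finite_image_irreps n G \<and> d = e \<and> equivalent_rep G d \<rho> \<sigma>}"

definition Rep :: "nat \<Rightarrow> ('a, 'b) monoid_scheme \<Rightarrow> enat" where
  "Rep n G = ecard (finite_image_irreps n G // rep_equivalence n G)"

end

theory Submission
  imports Defs "Jordan_Normal_Form.Char_Poly"
begin

text \<open>
  A finitely generated torsion group has FAb: its subgroups of finite index are again finitely
  generated (\<open>finite_index_subgroup_finitely_generated\<close>) and torsion, and a finitely generated
  abelian torsion group is finite. It therefore suffices to construct a residually finite
  torsion group with two generators in which, for infinitely many \<open>n\<close>, a normal subgroup of
  index \<open>n\<close> has a cyclic image whose order exceeds a prescribed function of \<open>n\<close>.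

  The group is the limit of a chain of finite groups, each a quotient of the next. Torsion is
  imposed on one word at a time, as in Schlage-Puchta's construction of torsion groups of
  positive rank gradient. Let \<open>N\<close> be the kernel of a map from a free group of rank \<open>d\<close> onto a
  group of order \<open>n\<close>. Its homomorphisms to \<open>\<int>\<close> form a group of rank \<open>n (d - 1) + 1\<close>. If \<open>s\<close>
  has order exactly \<open>q\<close> modulo \<open>N\<close>, then \<open>s\<^sup>q\<close> commutes with \<open>s\<close>, so it has at most \<open>n/q\<close>
  conjugates modulo \<open>[N, N]\<close>, and killing them imposes at most \<open>n/q\<close> linear conditions. While
  the sum of the \<open>1/q\<close> stays below \<open>d - 1\<close>, a nonzero homomorphism \<open>N \<rightarrow> \<int>\<close> that respects all
  relations remains (\<open>nontrivial_voltage_exists\<close>). Its reduction modulo a large integer gives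
  the next finite quotient, in which \<open>N\<close> has as large a cyclic image as desired
  (\<open>exists_cover_with_cyclic_quotient\<close>). Afterwards the next word is made periodic at a small
  cost, either by a relation with large \<open>q\<close> or for free (\<open>exists_refinement_killing_power\<close>).
  Later quotients refine this one, so the cyclic image of \<open>N\<close> persists in the limit, where \<open>N\<close>
  still has index \<open>n\<close>.

  For representations, let \<open>h \<in> N\<close> have an image of order \<open>M\<close> in the cyclic image. The powers
  of a faithful character of the latter, induced from \<open>N\<close>, give monomial representations of
  degree \<open>n\<close> in which \<open>h\<close> has the value of the character as an eigenvalue with a cyclic
  eigenvector; \<open>M\<close> different values occur. An irreducible quotient has degree at most \<open>n\<close> and
  keeps this eigenvalue (\<open>exists_irreducible_with_eigenvalue\<close>). As \<open>h\<close> has at most \<open>n\<close>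
  eigenvalues in it, at least \<open>M/n\<close> inequivalent representations arise
  (\<open>Rep_ge_of_eigenvalues\<close>).
\<close>

section \<open>Words and congruences with a periodic quotient\<close>

definition wpow :: "'a list \<Rightarrow> nat \<Rightarrow> 'a list" where
  "wpow w k = concat (replicate k w)"

lemma wpow_0 [simp]: "wpow w 0 = []"
  by (simp add: wpow_def)

lemma wpow_1 [simp]: "wpow w (Suc 0) = w"
  by (simp add: wpow_def)

lemma wpow_Suc: "wpow w (Suc k) = w @ wpow w k"
  by (simp add: wpow_def)

lemma wpow_add: "wpow w (a + b) = wpow w a @ wpow w b"
  by (simp add: wpow_def replicate_add)

lemma wpow_mult: "wpow w (a * b) = wpow (wpow w a) b"
  by (induction b) (simp_all add: wpow_add wpow_Suc)

lemma wpow_Suc': "wpow w (Suc k) = wpow w k @ w"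
  using wpow_add[of w k 1] by simp

text \<open>A monoid of words modulo a congruence is a group as soon as every element is periodic, because
  the inverse of \<open>w\<close> is then a power of \<open>w\<close>. A torsion group can therefore be presented by
  words in positive letters, and the free group never has to be formed. The relation \<open>E\<close> plays
  the part of a normal subgroup of the free group: \<open>(w, []) \<in> E\<close> says that \<open>w\<close> lies in it.\<close>

locale group_congruence =
  fixes E :: "('a list \<times> 'a list) set"
  assumes equiv: "equiv UNIV E"
    and append: "(u, u') \<in> E \<Longrightarrow> (v, v') \<in> E \<Longrightarrow> (u @ v, u' @ v') \<in> E"
    and periodic: "\<exists>k>0. (wpow w k, []) \<in> E"
begin

lemma refl [simp]: "(u, u) \<in> E"
  using equiv by (auto simp: equiv_def refl_on_def)

lemma sym: "(u, v) \<in> E \<Longrightarrow> (v, u) \<in> E"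
  using equiv by (auto simp: equiv_def sym_def)

lemma trans [trans]: "(u, v) \<in> E \<Longrightarrow> (v, w) \<in> E \<Longrightarrow> (u, w) \<in> E"
  using equiv by (auto simp: equiv_def trans_def)

lemma class_eq_iff: "E `` {u} = E `` {v} \<longleftrightarrow> (u, v) \<in> E"
  using eq_equiv_class_iff[OF equiv] by auto

lemma inverse_exists: "\<exists>v. (w @ v, []) \<in> E \<and> (v @ w, []) \<in> E"
proof -
  obtain k where k: "k > 0" "(wpow w k, []) \<in> E" using periodic by blast
  then obtain j where "k = Suc j" by (cases k) auto
  then have "(w @ wpow w j, []) \<in> E" "(wpow w j @ w, []) \<in> E"
    using k wpow_Suc[of w j] wpow_Suc'[of w j] by simp_all
  then show ?thesis by blast
qed

lemma append_left: "(u, v) \<in> E \<Longrightarrow> (x @ u, x @ v) \<in> E"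
  by (simp add: append)

lemma append_right: "(u, v) \<in> E \<Longrightarrow> (u @ x, v @ x) \<in> E"
  by (simp add: append)

lemma cancel_left: "(x @ u, x @ v) \<in> E \<longleftrightarrow> (u, v) \<in> E"
proof
  assume *: "(x @ u, x @ v) \<in> E"
  obtain y where y: "(y @ x, []) \<in> E" using inverse_exists by blast
  have "(u, y @ x @ u) \<in> E" using append_right[OF sym[OF y], of u] by simp
  also have "(y @ x @ u, y @ x @ v) \<in> E" by (rule append_left[OF *])
  also have "(y @ x @ v, v) \<in> E" using append_right[OF y, of v] by simp
  finally show "(u, v) \<in> E" .
qed (rule append_left)

lemma append_trivial_iff: "(x @ u, x) \<in> E \<longleftrightarrow> (u, []) \<in> E"
  using cancel_left[of x u "[]"] by simp

lemma wpow_trivial: "(w, []) \<in> E \<Longrightarrow> (wpow w k, []) \<in> E"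
  by (induction k) (use append in \<open>fastforce simp: wpow_Suc\<close>)+

lemma wpow_trivial_dvd: "(wpow w k, []) \<in> E \<Longrightarrow> k dvd j \<Longrightarrow> (wpow w j, []) \<in> E"
  by (auto simp: wpow_mult wpow_trivial)

end

locale finite_group_congruence = group_congruence +
  assumes finite_quotient: "finite (UNIV // E)"

definition has_order :: "('a list \<times> 'a list) set \<Rightarrow> 'a list \<Rightarrow> nat \<Rightarrow> bool" where
  "has_order E s q \<longleftrightarrow> q > 0 \<and> (\<forall>j. (wpow s j, []) \<in> E \<longleftrightarrow> q dvd j)"

lemma (in group_congruence) order_exists: "\<exists>q. has_order E s q"
proof -
  define q where "q = (LEAST k. k > 0 \<and> (wpow s k, []) \<in> E)"
  have q: "q > 0 \<and> (wpow s q, []) \<in> E"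
    unfolding q_def by (rule LeastI_ex) (use periodic in blast)
  have "q dvd j" if j: "(wpow s j, []) \<in> E" for j
  proof (rule ccontr)
    assume "\<not> q dvd j"
    then have r: "j mod q > 0" by (simp add: mod_greater_zero_iff_not_dvd)
    have split: "wpow s j = wpow s (q * (j div q)) @ wpow s (j mod q)"
      by (metis mult_div_mod_eq wpow_add)
    have "(wpow s (q * (j div q)), []) \<in> E"
      by (rule wpow_trivial_dvd[OF conjunct2[OF q]]) simp
    then have "(wpow s j, wpow s (j mod q)) \<in> E"
      unfolding split using append_right by fastforce
    then have "(wpow s (j mod q), []) \<in> E"
      using j trans sym by blast
    then have "q \<le> j mod q" unfolding q_def by (intro Least_le) (use r q_def in auto)
    then show False using q mod_less_divisor[of q j] by linarith
  qed
  then show ?thesis using q wpow_trivial_dvd unfolding has_order_def by blast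
qed

text \<open>Passing to a finer quotient can only enlarge an order to a multiple, and the surviving
  relation \<open>s\<^sup>q = 1\<close> prevents this. So the orders recorded at one stage of the construction
  stay exact at all later stages.\<close>

lemma has_order_refine:
  assumes "group_congruence E'" "E' \<subseteq> E" "has_order E s q" "(wpow s q, []) \<in> E'"
  shows "has_order E' s q"
  using assms group_congruence.wpow_trivial_dvd unfolding has_order_def by blast

lemma finite_quotientI:
  assumes "equiv UNIV E" and "finite (range f)" and "\<And>u v. f u = f v \<Longrightarrow> (u, v) \<in> E"
  shows "finite (UNIV // E)"
proof -
  have "E `` {u} = E `` {inv_into UNIV f (f u)}" for u
    by (rule equiv_class_eq[OF assms(1)], rule assms(3)) (simp add: f_inv_into_f)
  then have "UNIV // E \<subseteq> (\<lambda>y. E `` {inv_into UNIV f y}) ` range f"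
    unfolding quotient_def by blast
  then show ?thesis using assms(2) finite_surj by blast
qed

section \<open>Voltages on the Cayley graph\<close>

text \<open>A homomorphism to \<open>\<int>\<close> from the kernel \<open>N\<close> of a finite quotient \<open>Q\<close> of a free group is the
  same, up to coboundaries, as an integer label (a voltage) on every edge of the Cayley graph
  of \<open>Q\<close>: its value at \<open>h \<in> N\<close> is the total voltage along the closed path \<open>h\<close>. Vertices are
  represented by words, and invariance under the congruence is the condition \<open>voltage_on\<close>
  below.\<close>

fun net_voltage :: "('a list \<Rightarrow> 'a \<Rightarrow> int) \<Rightarrow> 'a list \<Rightarrow> 'a list \<Rightarrow> int" where
  "net_voltage \<alpha> x [] = 0"
| "net_voltage \<alpha> x (a # w) = \<alpha> x a + net_voltage \<alpha> (x @ [a]) w"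

lemma net_voltage_append:
  "net_voltage \<alpha> x (u @ v) = net_voltage \<alpha> x u + net_voltage \<alpha> (x @ u) v"
  by (induction u arbitrary: x) simp_all

definition voltage_on :: "('a list \<times> 'a list) set \<Rightarrow> ('a list \<Rightarrow> 'a \<Rightarrow> int) \<Rightarrow> bool" where
  "voltage_on E \<alpha> \<longleftrightarrow> (\<forall>(x, y) \<in> E. \<alpha> x = \<alpha> y)"

text \<open>Words are compared by their voltages from every vertex and not only from the base vertex. This
  replaces the kernel of the character modulo \<open>m\<close> by the intersection of its conjugates, and
  so makes the relation a congruence.\<close>

definition voltage_cover ::
  "('a list \<times> 'a list) set \<Rightarrow> ('a list \<Rightarrow> 'a \<Rightarrow> int) \<Rightarrow> int \<Rightarrow> ('a list \<times> 'a list) set" where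
  "voltage_cover E \<alpha> m =
     {(u, v). (u, v) \<in> E \<and> (\<forall>x. m dvd net_voltage \<alpha> x u - net_voltage \<alpha> x v)}"

context group_congruence
begin

lemma net_voltage_cong:
  assumes "voltage_on E \<alpha>" "(x, y) \<in> E"
  shows "net_voltage \<alpha> x w = net_voltage \<alpha> y w"
  using assms(2)
proof (induction w arbitrary: x y)
  case (Cons a w)
  then have "\<alpha> x = \<alpha> y" using assms(1) by (auto simp: voltage_on_def)
  moreover have "net_voltage \<alpha> (x @ [a]) w = net_voltage \<alpha> (y @ [a]) w"
    using Cons append_right by blast
  ultimately show ?case by simp
qed simp

lemma net_voltage_append_trivial:
  assumes "voltage_on E \<alpha>" "(u, []) \<in> E"
  shows "net_voltage \<alpha> x (u @ v) = net_voltage \<alpha> x u + net_voltage \<alpha> x v"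
  using net_voltage_cong[OF assms(1), of "x @ u" x] assms(2)
  by (simp add: net_voltage_append append_trivial_iff)

lemma net_voltage_wpow:
  assumes "voltage_on E \<alpha>" "(u, []) \<in> E"
  shows "net_voltage \<alpha> x (wpow u k) = int k * net_voltage \<alpha> x u"
  by (induction k) (simp_all add: wpow_Suc net_voltage_append_trivial[OF assms] algebra_simps)

text \<open>A power of \<open>w\<close> that is trivial for \<open>E\<close> is a closed path from every vertex; its own \<open>m\<close>-th
  power runs \<open>m\<close> times through that path and has voltage divisible by \<open>m\<close>. So periodicity is
  inherited.\<close>

lemma group_congruence_voltage_cover:
  assumes \<alpha>: "voltage_on E \<alpha>" and m: "m > 0"
  shows "group_congruence (voltage_cover E \<alpha> m)"
proof
  let ?E = "voltage_cover E \<alpha> m"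
  show "equiv UNIV ?E"
  proof (rule equivI)
    show "refl ?E" by (auto simp: refl_on_def voltage_cover_def)
    show "sym ?E"
    proof (rule symI)
      fix u v assume uv: "(u, v) \<in> ?E"
      have "m dvd net_voltage \<alpha> x v - net_voltage \<alpha> x u" for x
        using uv dvd_diff_commute[of m] unfolding voltage_cover_def by blast
      then show "(v, u) \<in> ?E" using uv sym by (simp add: voltage_cover_def)
    qed
    show "trans ?E"
    proof (rule transI)
      fix u v w assume uv: "(u, v) \<in> ?E" and vw: "(v, w) \<in> ?E"
      have "m dvd net_voltage \<alpha> x u - net_voltage \<alpha> x w" for x
        using dvd_add[of m "net_voltage \<alpha> x u - net_voltage \<alpha> x v" "net_voltage \<alpha> x v - net_voltage \<alpha> x w"]
          uv vw by (auto simp: voltage_cover_def)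
      then show "(u, w) \<in> ?E" using uv vw trans by (auto simp: voltage_cover_def)
    qed
  qed simp
  show "(u @ v, u' @ v') \<in> ?E" if u: "(u, u') \<in> ?E" and v: "(v, v') \<in> ?E" for u u' v v'
  proof -
    have "m dvd net_voltage \<alpha> x (u @ v) - net_voltage \<alpha> x (u' @ v')" for x
    proof -
      have "net_voltage \<alpha> (x @ u') v' = net_voltage \<alpha> (x @ u) v'"
        by (rule net_voltage_cong[OF \<alpha>]) (use u sym append_left in \<open>auto simp: voltage_cover_def\<close>)
      then have "net_voltage \<alpha> x (u @ v) - net_voltage \<alpha> x (u' @ v') =
          (net_voltage \<alpha> x u - net_voltage \<alpha> x u')
          + (net_voltage \<alpha> (x @ u) v - net_voltage \<alpha> (x @ u) v')"
        by (simp add: net_voltage_append)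
      then show ?thesis using u v by (simp add: voltage_cover_def)
    qed
    then show ?thesis using u v append by (auto simp: voltage_cover_def)
  qed
  show "\<exists>k>0. (wpow w k, []) \<in> ?E" for w
  proof -
    obtain k where k: "k > 0" "(wpow w k, []) \<in> E" using periodic by blast
    have "(wpow w (k * nat m), []) \<in> ?E"
      using k m wpow_trivial[OF k(2)] net_voltage_wpow[OF \<alpha> k(2)]
      by (auto simp: voltage_cover_def wpow_mult)
    then show ?thesis using k m by (intro exI[of _ "k * nat m"]) auto
  qed
qed

end

lemma (in finite_group_congruence) finite_group_congruence_voltage_cover:
  assumes \<alpha>: "voltage_on E \<alpha>" and m: "m > 0"
  shows "finite_group_congruence (voltage_cover E \<alpha> m)"
proof -
  interpret E': group_congruence "voltage_cover E \<alpha> m"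
    by (rule group_congruence_voltage_cover[OF assms])
  define r where "r X = (SOME x. x \<in> X)" for X :: "'a list set"
  have r: "(x, r (E `` {x})) \<in> E" for x
    unfolding r_def using someI[of "\<lambda>y. y \<in> E `` {x}" x] by simp
  define f where
    "f u = (E `` {u}, (\<lambda>X. if X \<in> UNIV // E then net_voltage \<alpha> (r X) u mod m else 0))" for u
  have "range f \<subseteq> (UNIV // E) \<times> {g. \<forall>X. (X \<in> UNIV // E \<longrightarrow> g X \<in> {0..<m}) \<and> (X \<notin> UNIV // E \<longrightarrow> g X = 0)}"
    using m by (auto simp: f_def quotient_def)
  moreover have "finite {g. \<forall>X. (X \<in> UNIV // E \<longrightarrow> g X \<in> {0..<m}) \<and> (X \<notin> UNIV // E \<longrightarrow> g X = 0)}"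
    by (rule finite_set_of_finite_funs[OF finite_quotient]) simp
  ultimately have "finite (range f)"
    using finite_quotient finite_subset by blast
  moreover have "(u, v) \<in> voltage_cover E \<alpha> m" if "f u = f v" for u v
  proof -
    have uv: "(u, v) \<in> E" using that by (simp add: f_def class_eq_iff)
    moreover have "m dvd net_voltage \<alpha> x u - net_voltage \<alpha> x v" for x
    proof -
      have "snd (f u) (E `` {x}) = snd (f v) (E `` {x})" using that by simp
      then have "net_voltage \<alpha> (r (E `` {x})) u mod m = net_voltage \<alpha> (r (E `` {x})) v mod m"
        by (simp add: f_def quotientI)
      then have "net_voltage \<alpha> x u mod m = net_voltage \<alpha> x v mod m"
        by (simp add: net_voltage_cong[OF \<alpha> r[of x]])
      then show ?thesis by (simp add: mod_eq_dvd_iff)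
    qed
    ultimately show ?thesis by (simp add: voltage_cover_def)
  qed
  ultimately have "finite (UNIV // voltage_cover E \<alpha> m)"
    by (rule finite_quotientI[OF E'.equiv])
  then show ?thesis by unfold_locales
qed

section \<open>Existence of a voltage that respects given relations\<close>

definition linear_form :: "(('i \<Rightarrow> int) \<Rightarrow> int) \<Rightarrow> bool" where
  "linear_form L \<longleftrightarrow> (\<forall>a b z w. L (\<lambda>i. a * z i + b * w i) = a * L z + b * L w)"

text \<open>Equations are linear forms rather than rows of a matrix, since voltages along a word are
  linear in the edge labels without having convenient coefficients. To add a form \<open>L\<close>, take
  two solutions of the other equations, the second vanishing at a point where the first does
  not: the combination that cancels \<open>L\<close> is again nonzero. This needs only a spare unknown and
  works over \<open>\<int>\<close>.\<close>

lemma underdetermined_system_has_solution: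
  assumes "finite Ls" "finite I" "card Ls < card I" "\<And>L. L \<in> Ls \<Longrightarrow> linear_form L"
  shows "\<exists>z. (\<forall>i. i \<notin> I \<longrightarrow> z i = 0) \<and> (\<exists>i\<in>I. z i \<noteq> 0) \<and> (\<forall>L\<in>Ls. L z = 0)"
  using assms
proof (induction Ls arbitrary: I)
  case empty
  then obtain i where "i \<in> I" by fastforce
  then show ?case by (intro exI[of _ "\<lambda>j. if j = i then 1 else 0"]) auto
next
  case (insert L Ls)
  have lin: "linear_form M" if "M \<in> Ls" for M using that insert.prems(3) by blast
  have linL: "linear_form L" using insert.prems(3) by blast
  have drop: "\<exists>z. (\<forall>j. j \<notin> I - {i} \<longrightarrow> z j = 0) \<and> (\<exists>j\<in>I - {i}. z j \<noteq> 0) \<and> (\<forall>L\<in>Ls. L z = 0)"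
    if "i \<in> I" for i
    by (rule insert.IH) (use that insert lin in auto)
  obtain i0 where "i0 \<in> I" using insert.prems by fastforce
  then obtain z1 i1 where z1: "\<forall>j. j \<notin> I \<longrightarrow> z1 j = 0" "i1 \<in> I" "z1 i1 \<noteq> 0" "\<forall>L\<in>Ls. L z1 = 0"
    using drop[of i0] by blast
  obtain z2 i2 where z2: "\<forall>j. j \<notin> I - {i1} \<longrightarrow> z2 j = 0" "i2 \<in> I" "z2 i2 \<noteq> 0" "\<forall>L\<in>Ls. L z2 = 0"
    using drop[OF z1(2)] by blast
  show ?case
  proof (cases "L z2 = 0")
    case True
    then show ?thesis using z2 by (intro exI[of _ z2]) auto
  next
    case False
    let ?z = "\<lambda>i. L z2 * z1 i + (- L z1) * z2 i"
    have z: "M ?z = L z2 * M z1 + (- L z1) * M z2" if "M \<in> insert L Ls" for M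
      using insert.prems(3)[OF that] unfolding linear_form_def by blast
    have "\<forall>M\<in>insert L Ls. M ?z = 0"
    proof
      fix M assume M: "M \<in> insert L Ls"
      then have "M = L \<or> M z1 = 0 \<and> M z2 = 0" using z1(4) z2(4) by blast
      then show "M ?z = 0" unfolding z[OF M] by auto
    qed
    moreover have "\<exists>i\<in>I. ?z i \<noteq> 0"
      by (rule bexI[of _ i1]) (use False z1 z2 in simp_all)
    moreover have "\<forall>i. i \<notin> I \<longrightarrow> ?z i = 0" using z1(1) z2(1) by simp
    ultimately show ?thesis by (intro exI[of _ ?z] conjI)
  qed
qed

context finite_group_congruence
begin

text \<open>The classes are the orbits of right multiplication by \<open>s\<close> on the vertices. Orbits, and not
  vertices, index the equations that a relation \<open>s\<^sup>q = 1\<close> imposes on a voltage; this saves a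
  factor \<open>q\<close>.\<close>

definition cycle_relation :: "'a list \<Rightarrow> ('a list \<times> 'a list) set" where
  "cycle_relation s = {(x, y). \<exists>j. (x @ wpow s j, y) \<in> E}"

lemma equiv_cycle_relation: "equiv UNIV (cycle_relation s)"
proof (rule equivI)
  show "refl (cycle_relation s)"
    unfolding refl_on_def cycle_relation_def
    using refl by (auto intro!: exI[of _ 0])
  show "sym (cycle_relation s)"
  proof (rule symI)
    fix x y assume "(x, y) \<in> cycle_relation s"
    then obtain j where j: "(x @ wpow s j, y) \<in> E" by (auto simp: cycle_relation_def)
    obtain k where k: "k > 0" "(wpow (wpow s j) k, []) \<in> E" using periodic by blast
    have "(y @ wpow s (j * (k - 1)), x @ wpow s j @ wpow s (j * (k - 1))) \<in> E"
      using append_right[OF sym[OF j]] by simp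
    also have "wpow s j @ wpow s (j * (k - 1)) = wpow (wpow s j) k"
      using k(1) by (metis Suc_diff_1 wpow_Suc wpow_mult)
    also have "(x @ wpow (wpow s j) k, x) \<in> E"
      using k(2) by (simp add: append_trivial_iff)
    finally show "(y, x) \<in> cycle_relation s" by (auto simp: cycle_relation_def)
  qed
  show "trans (cycle_relation s)"
  proof (rule transI)
    fix x y z assume "(x, y) \<in> cycle_relation s" "(y, z) \<in> cycle_relation s"
    then obtain i j where "(x @ wpow s i, y) \<in> E" "(y @ wpow s j, z) \<in> E"
      by (auto simp: cycle_relation_def)
    then have "(x @ wpow s (i + j), z) \<in> E"
      using append_right[of "x @ wpow s i" y "wpow s j"] trans by (simp add: wpow_add)
    then show "(x, z) \<in> cycle_relation s" by (auto simp: cycle_relation_def)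
  qed
qed simp

text \<open>Right multiplication by an element of order \<open>q\<close> acts freely on the group in cycles of length
  \<open>q\<close>.\<close>

lemma cycle_count:
  assumes "has_order E s q"
  shows "finite (UNIV // cycle_relation s)"
    and "card (UNIV // cycle_relation s) * q \<le> card (UNIV // E)"
proof -
  let ?C = "UNIV // cycle_relation s"
  note eqC = equiv_cycle_relation[of s]
  define r where "r X = (SOME x. x \<in> X)" for X :: "'a list set"
  have r: "cycle_relation s `` {r X} = X" if X: "X \<in> ?C" for X
  proof -
    obtain x where x: "X = cycle_relation s `` {x}" using X by (rule quotientE)
    have "x \<in> X" unfolding x using equiv_class_self[OF eqC] by blast
    then have "r X \<in> X" unfolding r_def by (rule someI)
    then have "(x, r X) \<in> cycle_relation s" using x by blast
    then have "cycle_relation s `` {x} = cycle_relation s `` {r X}"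
      by (rule equiv_class_eq[OF eqC])
    then show ?thesis using x by argo
  qed
  define f where "f p = E `` {r (fst p) @ wpow s (snd p)}" for p
  have inj: "inj_on f (?C \<times> {..<q})"
  proof (rule inj_onI)
    fix p p' assume p: "p \<in> ?C \<times> {..<q}" and p': "p' \<in> ?C \<times> {..<q}" and "f p = f p'"
    obtain X i Y j where [simp]: "p = (X, i)" "p' = (Y, j)" by (cases p, cases p')
    have e: "(r X @ wpow s i, r Y @ wpow s j) \<in> E"
      using \<open>f p = f p'\<close> by (simp add: f_def class_eq_iff)
    have "(r X, r X @ wpow s i) \<in> cycle_relation s" "(r Y, r Y @ wpow s j) \<in> cycle_relation s"
      unfolding cycle_relation_def by (auto intro: refl)
    moreover have "(r X @ wpow s i, r Y @ wpow s j) \<in> cycle_relation s"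
      using e by (auto simp: cycle_relation_def intro!: exI[of _ 0])
    ultimately have "(r X, r Y) \<in> cycle_relation s"
      using eqC by (meson equiv_def symD transD)
    then have "cycle_relation s `` {r X} = cycle_relation s `` {r Y}"
      by (rule equiv_class_eq[OF eqC])
    then have XY: "X = Y" using r[of X] r[of Y] p p' by simp
    have "(wpow s i, wpow s j) \<in> E" using e XY cancel_left by simp
    have *: "a = b" if "(wpow s a, wpow s b) \<in> E" "a \<le> b" "b < q" for a b
    proof -
      have "(wpow s a @ wpow s (b - a), wpow s a) \<in> E"
        using that(1) sym \<open>a \<le> b\<close> by (simp flip: wpow_add)
      then have "q dvd b - a" using assms by (simp add: append_trivial_iff has_order_def)
      then show "a = b" using that(2,3) nat_dvd_not_less[of "b - a" q] by force
    qed
    have "i = j"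
    proof (cases "i \<le> j")
      case True
      then show ?thesis using *[of i j] \<open>(wpow s i, wpow s j) \<in> E\<close> p' by simp
    next
      case False
      then show ?thesis using *[of j i] sym[OF \<open>(wpow s i, wpow s j) \<in> E\<close>] p by simp
    qed
    then show "p = p'" using XY by simp
  qed
  have sub: "f ` (?C \<times> {..<q}) \<subseteq> UNIV // E" by (auto simp: f_def quotientI)
  have "q > 0" using assms by (simp add: has_order_def)
  have fin: "finite (?C \<times> {..<q})"
    using inj sub finite_quotient inj_on_finite by blast
  then show "finite ?C" using \<open>q > 0\<close> finite_cartesian_productD1[of ?C "{..<q}"] by auto
  have "card (?C \<times> {..<q}) \<le> card (UNIV // E)"
    by (rule card_inj_on_le[OF inj sub finite_quotient])
  then show "card ?C * q \<le> card (UNIV // E)" by (simp add: card_cartesian_product)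
qed

text \<open>Moving the starting point along the cycle permutes cyclically the edges that are traversed.\<close>

lemma net_voltage_around_cycle:
  assumes "voltage_on E \<alpha>" "(wpow s q, []) \<in> E" "(x, y) \<in> cycle_relation s"
  shows "net_voltage \<alpha> x (wpow s q) = net_voltage \<alpha> y (wpow s q)"
proof -
  obtain j where j: "(x @ wpow s j, y) \<in> E" using assms(3) by (auto simp: cycle_relation_def)
  have "net_voltage \<alpha> x (wpow s q) + net_voltage \<alpha> x (wpow s j) = net_voltage \<alpha> x (wpow s (q + j))"
    by (simp add: wpow_add net_voltage_append_trivial[OF assms(1,2)])
  also have "\<dots> = net_voltage \<alpha> x (wpow s j) + net_voltage \<alpha> (x @ wpow s j) (wpow s q)"
    by (simp add: add.commute[of q j] wpow_add net_voltage_append)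
  finally show ?thesis using net_voltage_cong[OF assms(1) j] by simp
qed

end

lemma linear_form_net_voltage:
  "linear_form (\<lambda>z. net_voltage (\<lambda>x a. z (c x, a)) x w)"
  unfolding linear_form_def
proof (intro allI)
  fix a b :: int and z y
  show "net_voltage (\<lambda>x l. a * z (c x, l) + b * y (c x, l)) x w =
    a * net_voltage (\<lambda>x a. z (c x, a)) x w + b * net_voltage (\<lambda>x a. y (c x, a)) x w"
    by (induction w arbitrary: x) (simp_all add: algebra_simps)
qed

text \<open>Counting equations. On a Cayley graph with \<open>n\<close> vertices and \<open>d\<close> generators a voltage has \<open>nd\<close>
  unknowns. A relation \<open>s\<^sup>q = 1\<close> in which \<open>s\<close> has order exactly \<open>q\<close> costs \<open>n/q\<close> equations.
  Requiring in addition that the divergence vanishes at every vertex costs \<open>n\<close> equations, and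
  makes the voltage orthogonal to all differences of vertex potentials. If the voltages of all
  closed paths at the base point vanished, the voltage itself would be such a difference,
  hence orthogonal to itself and zero. So a nonzero solution, which exists while \<open>\<Sum> 1/q < d -
  1\<close>, is nonzero on some closed path.\<close>

lemma nontrivial_voltage_exists:
  fixes E :: "('a::finite list \<times> 'a list) set"
  assumes E: "finite_group_congruence E" and R: "finite R"
    and ord: "\<And>s q. (s, q) \<in> R \<Longrightarrow> has_order E s q"
    and deficiency: "(\<Sum>(s, q)\<in>R. 1 / real q) < real (card (UNIV :: 'a set)) - 1"
  shows "\<exists>\<alpha> h. voltage_on E \<alpha> \<and> (\<forall>(s, q)\<in>R. \<forall>x. net_voltage \<alpha> x (wpow s q) = 0)
           \<and> (h, []) \<in> E \<and> net_voltage \<alpha> [] h \<noteq> 0"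
proof -
  interpret finite_group_congruence E by fact
  let ?X = "UNIV // E" and ?C = "\<lambda>s. UNIV // cycle_relation s"
  let ?I = "?X \<times> (UNIV :: 'a set)"
  define n where "n = card ?X"
  have fin: "finite ?X" by (rule finite_quotient)
  have "E `` {[]} \<in> ?X" by (simp add: quotientI)
  then have n: "n > 0" using fin by (auto simp: n_def card_gt_0_iff)
  define r where "r X = (SOME x. x \<in> X)" for X :: "'a list set"
  have r: "E `` {r X} = X" if X: "X \<in> ?X" for X
  proof -
    obtain x where x: "X = E `` {x}" using X by (rule quotientE)
    have "x \<in> X" unfolding x by simp
    then have "r X \<in> X" unfolding r_def by (rule someI)
    then show ?thesis unfolding x by (simp add: class_eq_iff sym)
  qed
  define volt where "volt z = (\<lambda>x a. z (E `` {x}, a))" for z :: "'a list set \<times> 'a \<Rightarrow> int"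
  have volt: "voltage_on E (volt z)" for z
    by (auto simp: voltage_on_def volt_def class_eq_iff[symmetric])
  define target where "target X a = E `` {r X @ [a]}" for X and a :: 'a
  \<comment> \<open>the voltage flowing into \<open>Y\<close> minus the voltage flowing out of \<open>Y\<close>\<close>
  define divergence where
    "divergence Y z = (\<Sum>(X, a)\<in>?I. z (X, a) * (of_bool (target X a = Y) - of_bool (X = Y)))"
    for Y and z :: "'a list set \<times> 'a \<Rightarrow> int"
  \<comment> \<open>one equation per cycle of \<open>s\<close>: the voltage of \<open>s\<^sup>q\<close> is the same from all of its vertices\<close>
  define around where "around s q X z = net_voltage (volt z) (r X) (wpow s q)"
    for s q X and z :: "'a list set \<times> 'a \<Rightarrow> int"
  have lin_div: "linear_form (divergence Y)" for Y
    unfolding linear_form_def divergence_def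
    by (simp add: sum_distrib_left sum.distrib[symmetric] case_prod_unfold algebra_simps)
  have lin_around: "linear_form (around s q X)" for s q X
    unfolding around_def volt_def by (rule linear_form_net_voltage)
  define Ls where "Ls = divergence ` ?X \<union> (\<Union>p\<in>R. around (fst p) (snd p) ` ?C (fst p))"
  have finC: "finite (?C (fst p))" if "p \<in> R" for p
    using cycle_count(1)[OF ord[of "fst p" "snd p"]] that by simp
  have "finite Ls" unfolding Ls_def using fin R finC by auto
  moreover have "card Ls < card ?I"
  proof -
    have "real (card Ls) \<le> real (card (divergence ` ?X) + card (\<Union>p\<in>R. around (fst p) (snd p) ` ?C (fst p)))"
      unfolding Ls_def of_nat_le_iff by (rule card_Un_le)
    also have "\<dots> \<le> real (n + (\<Sum>p\<in>R. card (?C (fst p))))"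
      unfolding of_nat_le_iff n_def
      by (intro add_mono card_image_le[OF fin] order_trans[OF card_UN_le[OF R]] sum_mono
          card_image_le finC)
    also have "\<dots> = real n + (\<Sum>p\<in>R. real (card (?C (fst p))))" by simp
    also have "(\<Sum>p\<in>R. real (card (?C (fst p)))) \<le> (\<Sum>p\<in>R. real n * (1 / real (snd p)))"
    proof (rule sum_mono)
      fix p assume p: "p \<in> R"
      then have o: "has_order E (fst p) (snd p)" using ord by simp
      have "real (card (?C (fst p)) * snd p) \<le> real n"
        unfolding of_nat_le_iff n_def by (rule cycle_count(2)[OF o])
      moreover have "snd p > 0" using o by (simp add: has_order_def)
      ultimately show "real (card (?C (fst p))) \<le> real n * (1 / real (snd p))"
        by (simp add: field_simps)
    qed
    also have "real n + (\<Sum>p\<in>R. real n * (1 / real (snd p)))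
        = real n * (1 + (\<Sum>(s, q)\<in>R. 1 / real q))"
      by (simp add: sum_distrib_left algebra_simps case_prod_unfold)
    also have "\<dots> < real n * real (card (UNIV :: 'a set))"
      using deficiency n by simp
    also have "\<dots> = real (card ?I)" by (simp add: card_cartesian_product n_def)
    finally show ?thesis by simp
  qed
  moreover have "linear_form L" if "L \<in> Ls" for L
    using that lin_div lin_around unfolding Ls_def by blast
  ultimately obtain z where z: "\<exists>i\<in>?I. z i \<noteq> 0" "\<And>L. L \<in> Ls \<Longrightarrow> L z = 0"
    using underdetermined_system_has_solution[of Ls ?I] fin by (metis finite_SigmaI finite_UNIV)
  let ?\<alpha> = "volt z"
  have relators: "net_voltage ?\<alpha> x (wpow s q) = 0" if p: "(s, q) \<in> R" for s q x
  proof -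
    let ?X = "cycle_relation s `` {x}"
    have eqC: "equiv UNIV (cycle_relation s)" by (rule equiv_cycle_relation)
    have "x \<in> ?X" by (rule equiv_class_self[OF eqC]) simp
    then have "r ?X \<in> ?X" unfolding r_def by (rule someI)
    then have "net_voltage ?\<alpha> x (wpow s q) = net_voltage ?\<alpha> (r ?X) (wpow s q)"
      using ord[OF p] by (intro net_voltage_around_cycle[OF volt]) (auto simp: has_order_def)
    moreover have "around s q ?X \<in> Ls"
      unfolding Ls_def using p by (force simp: quotientI)
    then have "around s q ?X z = 0" by (rule z(2))
    ultimately show ?thesis by (simp add: around_def)
  qed
  have "\<exists>h. (h, []) \<in> E \<and> net_voltage ?\<alpha> [] h \<noteq> 0"
  proof (rule ccontr)
    assume "\<not> ?thesis"
    then have closed: "net_voltage ?\<alpha> [] h = 0" if "(h, []) \<in> E" for h using that by blast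
    \<comment> \<open>with all closed paths trivial, the voltage of a path from the base point is a vertex potential\<close>
    have potential: "net_voltage ?\<alpha> [] x = net_voltage ?\<alpha> [] y" if xy: "(x, y) \<in> E" for x y
    proof -
      obtain v where v: "(x @ v, []) \<in> E" using inverse_exists by blast
      have "(y @ v, []) \<in> E" using append_right[OF sym[OF xy]] v by (rule trans)
      then show ?thesis
        using closed[OF v] closed[of "y @ v"] net_voltage_cong[OF volt xy]
        by (simp add: net_voltage_append)
    qed
    define b where "b Y = net_voltage ?\<alpha> [] (r Y)" for Y
    have edge: "z (X, a) = b (target X a) - b X" if X: "X \<in> ?X" for X a
    proof -
      have "(r (target X a), r X @ [a]) \<in> E"
        using r[of "target X a"] by (simp add: target_def class_eq_iff quotientI)
      then have "b (target X a) = net_voltage ?\<alpha> [] (r X @ [a])"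
        unfolding b_def by (rule potential)
      then show ?thesis using r[OF X] by (simp add: b_def net_voltage_append volt_def)
    qed
    have pick: "(\<Sum>Y\<in>?X. b Y * of_bool (W = Y)) = b W" if "W \<in> ?X" for W
    proof -
      have "(\<Sum>Y\<in>?X. b Y * of_bool (W = Y)) = (\<Sum>Y\<in>?X. if W = Y then b Y else 0)"
        by (intro sum.cong) auto
      then show ?thesis using that fin by simp
    qed
    \<comment> \<open>pairing the potential with the divergence is pairing its differences, that is \<open>z\<close>, with \<open>z\<close>\<close>
    have "divergence Y z = 0" if "Y \<in> ?X" for Y
      by (rule z(2)) (use that in \<open>simp add: Ls_def\<close>)
    then have "0 = (\<Sum>Y\<in>?X. b Y * divergence Y z)" by simp
    also have "\<dots> = (\<Sum>Y\<in>?X. \<Sum>i\<in>?I. z i * (b Y * of_bool (target (fst i) (snd i) = Y) - b Y * of_bool (fst i = Y)))"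
      unfolding divergence_def sum_distrib_left
      by (intro sum.cong HOL.refl) (simp add: case_prod_unfold algebra_simps)
    also have "\<dots> = (\<Sum>i\<in>?I. \<Sum>Y\<in>?X. z i * (b Y * of_bool (target (fst i) (snd i) = Y) - b Y * of_bool (fst i = Y)))"
      by (rule sum.swap)
    also have "\<dots> = (\<Sum>i\<in>?I. z i * z i)"
    proof (rule sum.cong[OF HOL.refl])
      fix i assume i: "i \<in> ?I"
      have "target (fst i) (snd i) \<in> ?X" by (simp add: target_def quotientI)
      then have "(\<Sum>Y\<in>?X. z i * (b Y * of_bool (target (fst i) (snd i) = Y) - b Y * of_bool (fst i = Y)))
          = z i * (b (target (fst i) (snd i)) - b (fst i))"
        using i pick unfolding sum_distrib_left[symmetric] sum_subtractf by (simp add: mem_Times_iff)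
      then show "(\<Sum>Y\<in>?X. z i * (b Y * of_bool (target (fst i) (snd i) = Y) - b Y * of_bool (fst i = Y)))
          = z i * z i"
        using edge[of "fst i" "snd i"] i by (simp add: mem_Times_iff)
    qed
    finally have "\<forall>i\<in>?I. z i * z i = 0"
      using sum_nonneg_eq_0_iff[of ?I "\<lambda>i. z i * z i"] fin by simp
    then show False using z(1) by auto
  qed
  then show ?thesis using volt relators by blast
qed

section \<open>The chain of finite quotients\<close>

definition has_orders :: "('a list \<times> 'a list) set \<Rightarrow> ('a list \<times> nat) set \<Rightarrow> bool" where
  "has_orders E R \<longleftrightarrow> (\<forall>(s, q)\<in>R. has_order E s q)"

text \<open>The modulus is \<open>\<bar>a\<bar> M\<close>, where \<open>a \<noteq> 0\<close> is the voltage of the closed path \<open>h\<close>: the multiples of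
  \<open>a\<close> then take exactly \<open>M\<close> values. The relations in \<open>R\<close> have voltage \<open>0\<close> in \<open>\<int>\<close>, so they
  persist in the cover however large the modulus is.\<close>

lemma exists_cover_with_cyclic_quotient:
  fixes E :: "('a::finite list \<times> 'a list) set" and M :: nat
  assumes E: "finite_group_congruence E" and R: "finite R" and ord: "has_orders E R"
    and deficiency: "(\<Sum>(s, q)\<in>R. 1 / real q) < real (card (UNIV :: 'a set)) - 1" and M: "M > 0"
  shows "\<exists>\<alpha> h m. voltage_on E \<alpha> \<and> m > 0 \<and> (h, []) \<in> E
           \<and> finite_group_congruence (voltage_cover E \<alpha> m) \<and> has_orders (voltage_cover E \<alpha> m) R
           \<and> inj_on (\<lambda>j. net_voltage \<alpha> [] (wpow h j) mod m) {..<M}"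
proof -
  interpret finite_group_congruence E by fact
  obtain \<alpha> h where \<alpha>: "voltage_on E \<alpha>"
    and kills: "\<And>s q x. (s, q) \<in> R \<Longrightarrow> net_voltage \<alpha> x (wpow s q) = 0"
    and h: "(h, []) \<in> E" "net_voltage \<alpha> [] h \<noteq> 0"
    using nontrivial_voltage_exists[OF E R _ deficiency] ord unfolding has_orders_def by blast
  let ?a = "net_voltage \<alpha> [] h"
  define m where "m = \<bar>?a\<bar> * int M"
  have m: "m > 0" using h M by (simp add: m_def)
  have fgc: "finite_group_congruence (voltage_cover E \<alpha> m)"
    by (rule finite_group_congruence_voltage_cover[OF \<alpha> m])
  have "has_orders (voltage_cover E \<alpha> m) R"
    unfolding has_orders_def
  proof (clarify)
    fix s q assume p: "(s, q) \<in> R"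
    have o: "has_order E s q" using ord p by (auto simp: has_orders_def)
    then have "(wpow s q, []) \<in> E" by (simp add: has_order_def)
    then have "(wpow s q, []) \<in> voltage_cover E \<alpha> m"
      using kills[OF p] by (simp add: voltage_cover_def)
    then show "has_order (voltage_cover E \<alpha> m) s q"
      by (rule has_order_refine[OF group_congruence_voltage_cover[OF \<alpha> m] _ o, rotated])
        (simp add: voltage_cover_def subset_iff)
  qed
  moreover have "inj_on (\<lambda>j. net_voltage \<alpha> [] (wpow h j) mod m) {..<M}"
  proof (rule inj_onI)
    fix i j assume i: "i \<in> {..<M}" and j: "j \<in> {..<M}"
      and eq: "net_voltage \<alpha> [] (wpow h i) mod m = net_voltage \<alpha> [] (wpow h j) mod m"
    have "m dvd ?a * (int i - int j)"
      using eq by (simp add: net_voltage_wpow[OF \<alpha> h(1)] mod_eq_dvd_iff algebra_simps)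
    then have "int M dvd int i - int j"
      using h(2) by (cases "?a > 0") (simp_all add: m_def)
    then show "i = j" using i j
      by (metis lessThan_iff mod_eq_dvd_iff mod_pos_pos_trivial of_nat_0_le_iff of_nat_eq_iff of_nat_less_iff)
  qed
  ultimately show ?thesis using \<alpha> m h fgc by blast
qed

text \<open>Either \<open>s\<close> has order at least \<open>B\<close> in some admissible finite quotient, and then its order there
  can be imposed as a new relation of weight at most \<open>1/B\<close>; or its order is below \<open>B\<close> in all
  of them, and then \<open>s\<close> to the power \<open>B!\<close> dies in all of them without any new relation. The
  conclusion speaks about all later quotients \<open>E''\<close> because a single exponent has to serve for
  their limit.\<close>

lemma exists_refinement_killing_power:
  fixes E :: "('a list \<times> 'a list) set"
  assumes E: "finite_group_congruence E" and R: "finite R" and ord: "has_orders E R" and B: "B > 0"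
  shows "\<exists>E' R' q. E' \<subseteq> E \<and> finite_group_congruence E' \<and> finite R' \<and> R \<subseteq> R' \<and> has_orders E' R'
    \<and> (\<Sum>(s, q)\<in>R'. 1 / real q) \<le> (\<Sum>(s, q)\<in>R. 1 / real q) + 1 / real B \<and> q > 0
    \<and> (\<forall>E''. E'' \<subseteq> E' \<longrightarrow> finite_group_congruence E'' \<longrightarrow> has_orders E'' R' \<longrightarrow> (wpow s q, []) \<in> E'')"
proof (cases "\<exists>E' q. E' \<subseteq> E \<and> finite_group_congruence E' \<and> has_orders E' R \<and> has_order E' s q \<and> q \<ge> B")
  case True
  then obtain E' q where E': "E' \<subseteq> E" "finite_group_congruence E'" "has_orders E' R"
    "has_order E' s q" "q \<ge> B" by blast
  let ?R = "insert (s, q) R"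
  have "(\<Sum>(s, q)\<in>?R. 1 / real q) \<le> (\<Sum>(s, q)\<in>R. 1 / real q) + 1 / real q"
    using R by (cases "(s, q) \<in> R") (simp_all add: insert_absorb)
  also have "1 / real q \<le> 1 / real B" using E'(5) B by (simp add: frac_le)
  finally have "(\<Sum>(s, q)\<in>?R. 1 / real q) \<le> (\<Sum>(s, q)\<in>R. 1 / real q) + 1 / real B" by simp
  moreover have "has_orders E' ?R" using E' by (simp add: has_orders_def)
  moreover have "q > 0" "(wpow s q, []) \<in> E''" if "has_orders E'' ?R" for E''
    using that by (auto simp: has_orders_def has_order_def)
  moreover have "q > 0" using B E' by simp
  ultimately show ?thesis using E' R by (intro exI[of _ E'] exI[of _ ?R] exI[of _ q]) auto
next
  case False
  have "(wpow s (fact B), []) \<in> E''"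
    if E'': "E'' \<subseteq> E" "finite_group_congruence E''" "has_orders E'' R" for E''
  proof -
    interpret E'': finite_group_congruence E'' by fact
    obtain q where q: "has_order E'' s q" using E''.order_exists by blast
    then have "\<not> B \<le> q" using False E'' by blast
    moreover have "q > 0" using q by (simp add: has_order_def)
    ultimately have "q dvd fact B" by (simp add: dvd_fact)
    then show ?thesis using q by (simp add: has_order_def)
  qed
  then show ?thesis using E R ord B
    by (intro exI[of _ E] exI[of _ R] exI[of _ "fact B"]) auto
qed

lemma card_quotient_less:
  assumes equiv: "equiv UNIV E" "equiv UNIV E'" and sub: "E' \<subset> E" and fin: "finite (UNIV // E')"
  shows "card (UNIV // E) < card (UNIV // E')"
proof -
  let ?f = "\<lambda>X. E `` X"
  have f: "E `` (E' `` {x}) = E `` {x}" for x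
    by (rule refines_equiv_class_eq2[OF psubset_imp_subset[OF sub] equiv(2,1)])
  have surj: "?f ` (UNIV // E') = UNIV // E"
    by (rule refines_equiv_image_eq[OF psubset_imp_subset[OF sub] equiv(2,1)])
  obtain x y where xy: "(x, y) \<in> E" "(x, y) \<notin> E'" using sub by auto
  have "\<not> inj_on ?f (UNIV // E')"
  proof
    assume "inj_on ?f (UNIV // E')"
    moreover have "?f (E' `` {x}) = ?f (E' `` {y})"
      unfolding f using xy(1) equiv_class_eq[OF equiv(1)] by blast
    ultimately have "E' `` {x} = E' `` {y}" by (rule inj_onD) (simp_all add: quotientI)
    then show False using xy(2) eq_equiv_class[OF _ equiv(2), of x y] by simp
  qed
  then have "card (?f ` (UNIV // E')) < card (UNIV // E')"
    by (meson card_image_le eq_card_imp_inj_on fin le_neq_implies_less)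
  then show ?thesis by (simp add: surj)
qed

text \<open>The kernel of \<open>E\<close> modulo the kernel of \<open>E'\<close> has a homomorphism to \<open>\<int>/m\<close> under which the first
  \<open>M\<close> powers of one element \<open>h\<close> have different images.\<close>

definition cyclic_quotient ::
  "('a list \<times> 'a list) set \<Rightarrow> ('a list \<times> 'a list) set \<Rightarrow> nat \<Rightarrow> bool" where
  "cyclic_quotient E E' M \<longleftrightarrow>
     (\<exists>\<alpha> h m. voltage_on E \<alpha> \<and> m > 0 \<and> (h, []) \<in> E \<and> E' \<subseteq> voltage_cover E \<alpha> m
        \<and> inj_on (\<lambda>j. net_voltage \<alpha> [] (wpow h j) mod m) {..<M})"

lemma exists_refinement_step:
  fixes E :: "('a::finite list \<times> 'a list) set"
  assumes E: "finite_group_congruence E" and R: "finite R" and ord: "has_orders E R"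
    and deficiency: "(\<Sum>(s, q)\<in>R. 1 / real q) < real (card (UNIV :: 'a set)) - 1"
    and M: "M \<ge> 2" and B: "B > 0"
  shows "\<exists>E' R' q. finite_group_congruence E' \<and> finite R' \<and> has_orders E' R'
    \<and> (\<Sum>(s, q)\<in>R'. 1 / real q) \<le> (\<Sum>(s, q)\<in>R. 1 / real q) + 1 / real B
    \<and> E' \<subseteq> E \<and> R \<subseteq> R' \<and> card (UNIV // E) < card (UNIV // E') \<and> cyclic_quotient E E' M \<and> q > 0
    \<and> (\<forall>E''. E'' \<subseteq> E' \<longrightarrow> finite_group_congruence E'' \<longrightarrow> has_orders E'' R' \<longrightarrow> (wpow s q, []) \<in> E'')"
proof -
  obtain \<alpha> h m where \<alpha>: "voltage_on E \<alpha>" "m > 0" "(h, []) \<in> E"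
      "finite_group_congruence (voltage_cover E \<alpha> m)" "has_orders (voltage_cover E \<alpha> m) R"
      and inj: "inj_on (\<lambda>j. net_voltage \<alpha> [] (wpow h j) mod m) {..<M}"
    using exists_cover_with_cyclic_quotient[OF E R ord deficiency, of M] M by auto
  obtain E' R' q where E': "E' \<subseteq> voltage_cover E \<alpha> m" "finite_group_congruence E'" "finite R'"
    "R \<subseteq> R'" "has_orders E' R'" "(\<Sum>(s, q)\<in>R'. 1 / real q) \<le> (\<Sum>(s, q)\<in>R. 1 / real q) + 1 / real B"
    "q > 0"
    "\<forall>E''. E'' \<subseteq> E' \<longrightarrow> finite_group_congruence E'' \<longrightarrow> has_orders E'' R' \<longrightarrow> (wpow s q, []) \<in> E''"
    using exists_refinement_killing_power[OF \<alpha>(4) R \<alpha>(5) B, of s] by metis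
  have cover: "voltage_cover E \<alpha> m \<subseteq> E" by (auto simp: voltage_cover_def)
  have "(h, []) \<notin> voltage_cover E \<alpha> m"
  proof
    assume "(h, []) \<in> voltage_cover E \<alpha> m"
    then have "net_voltage \<alpha> [] h mod m = net_voltage \<alpha> [] [] mod m"
      unfolding mod_eq_dvd_iff by (simp add: voltage_cover_def)
    then have "net_voltage \<alpha> [] (wpow h 1) mod m = net_voltage \<alpha> [] (wpow h 0) mod m" by simp
    then have "(1::nat) = 0" by (rule inj_onD[OF inj]) (use M in auto)
    then show False by simp
  qed
  then have proper: "E' \<subset> E" using E'(1) cover \<alpha>(3) by blast
  interpret E: finite_group_congruence E by fact
  interpret E': finite_group_congruence E' by fact
  have "card (UNIV // E) < card (UNIV // E')"
    by (rule card_quotient_less[OF E.equiv E'.equiv proper E'.finite_quotient])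
  moreover have "cyclic_quotient E E' M"
    unfolding cyclic_quotient_def using \<alpha>(1-3) inj E'(1) by blast
  ultimately show ?thesis using E' proper by (intro exI[of _ E'] exI[of _ R'] exI[of _ q]) simp
qed

text \<open>Step \<open>k\<close> spends weight \<open>1/2^(k+2)\<close> to make the \<open>k\<close>-th word periodic, so the total stays below
  \<open>1/2\<close>, while two generators allow every total below \<open>1\<close>. The prescribed function \<open>F\<close> is
  applied to the index of the stage just before the cover is chosen. This order of choices is
  what permits an arbitrary \<open>F\<close>. The offset \<open>2\<close> makes every cover proper, so that the indices
  grow.\<close>

lemma exists_periodic_chain:
  fixes F :: "nat \<Rightarrow> nat"
  shows "\<exists>E :: nat \<Rightarrow> (bool list \<times> bool list) set.
    (\<forall>k. finite_group_congruence (E k)) \<and> (\<forall>k. E (Suc k) \<subseteq> E k)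
    \<and> (\<forall>k. card (UNIV // E k) < card (UNIV // E (Suc k)))
    \<and> (\<forall>k. cyclic_quotient (E k) (E (Suc k)) (F (card (UNIV // E k)) + 2))
    \<and> (\<forall>w. \<exists>q>0. \<forall>k. (wpow w q, []) \<in> E k)"
proof -
  define P where "P k S \<longleftrightarrow> finite_group_congruence (fst S) \<and> finite (snd S) \<and> has_orders (fst S) (snd S)
    \<and> (\<Sum>(s, q)\<in>snd S. 1 / real q) \<le> 1/2 - 1 / 2 ^ Suc k"
    for k and S :: "(bool list \<times> bool list) set \<times> (bool list \<times> nat) set"
  define Q where "Q k S S' \<longleftrightarrow> fst S' \<subseteq> fst S \<and> snd S \<subseteq> snd S' \<and> card (UNIV // fst S) < card (UNIV // fst S')
    \<and> cyclic_quotient (fst S) (fst S') (F (card (UNIV // fst S)) + 2)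
    \<and> (\<exists>q>0. \<forall>E''. E'' \<subseteq> fst S' \<longrightarrow> finite_group_congruence E'' \<longrightarrow> has_orders E'' (snd S')
         \<longrightarrow> (wpow (from_nat k) q, []) \<in> E'')"
    for k and S S' :: "(bool list \<times> bool list) set \<times> (bool list \<times> nat) set"
  have equiv: "equiv UNIV (UNIV :: (bool list \<times> bool list) set)"
    by (auto simp: equiv_def refl_on_def sym_def trans_def)
  have "finite (UNIV // (UNIV :: (bool list \<times> bool list) set))"
    by (rule finite_quotientI[OF equiv, of "\<lambda>_. ()"]) simp_all
  then have "finite_group_congruence (UNIV :: (bool list \<times> bool list) set)"
    by unfold_locales (use equiv in auto)
  then have "P 0 (UNIV, {})" by (simp add: P_def has_orders_def)
  moreover have "\<exists>S'. P (Suc k) S' \<and> Q k S S'" if S: "P k S" for k S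
  proof -
    obtain E R where ER: "S = (E, R)" by (cases S)
    have E: "finite_group_congruence E" "finite R" "has_orders E R"
      and sum: "(\<Sum>(s, q)\<in>R. 1 / real q) \<le> 1/2 - 1 / 2 ^ Suc k"
      using S by (simp_all add: P_def ER)
    have "(0::real) < 1 / 2 ^ Suc k" by simp
    then have "(\<Sum>(s, q)\<in>R. 1 / real q) < 1" using sum by linarith
    then have "(\<Sum>(s, q)\<in>R. 1 / real q) < real (card (UNIV :: bool set)) - 1" by simp
    from exists_refinement_step[OF E this, of "F (card (UNIV // E)) + 2" "2 ^ Suc (Suc k)" "from_nat k"]
    obtain E' R' q where *: "finite_group_congruence E'" "finite R'" "has_orders E' R'"
      "(\<Sum>(s, q)\<in>R'. 1 / real q) \<le> (\<Sum>(s, q)\<in>R. 1 / real q) + 1 / real (2 ^ Suc (Suc k))"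
      "E' \<subseteq> E" "R \<subseteq> R'" "card (UNIV // E) < card (UNIV // E')"
      "cyclic_quotient E E' (F (card (UNIV // E)) + 2)" "q > 0"
      "\<forall>E''. E'' \<subseteq> E' \<longrightarrow> finite_group_congruence E'' \<longrightarrow> has_orders E'' R' \<longrightarrow> (wpow (from_nat k) q, []) \<in> E''"
      by auto
    have "(\<Sum>(s, q)\<in>R'. 1 / real q) \<le> 1/2 - 1 / 2 ^ Suc (Suc k)"
      using *(4) sum by simp
    then have "P (Suc k) (E', R')" using *(1-3) by (simp add: P_def)
    moreover have "Q k S (E', R')" unfolding Q_def ER using *(5-10) by auto
    ultimately show ?thesis by blast
  qed
  ultimately obtain S where S: "\<And>k. P k (S k)" "\<And>k. Q k (S k) (S (Suc k))"
    using dependent_nat_choice[of P Q] by blast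
  let ?E = "\<lambda>k. fst (S k)" and ?R = "\<lambda>k. snd (S k)"
  have fgc: "finite_group_congruence (?E k)" and ord: "has_orders (?E k) (?R k)" for k
    using S(1)[of k] by (simp_all add: P_def)
  have stepE: "?E (Suc k) \<subseteq> ?E k" and stepR: "?R k \<subseteq> ?R (Suc k)" for k
    using S(2)[of k] by (simp_all add: Q_def)
  have decE: "?E j \<subseteq> ?E i" if "i \<le> j" for i j
    using lift_Suc_antimono_le[of ?E, OF stepE that] .
  have incR: "?R i \<subseteq> ?R j" if "i \<le> j" for i j
    using lift_Suc_mono_le[of ?R, OF stepR that] .
  have "\<exists>q>0. \<forall>k. (wpow w q, []) \<in> ?E k" for w
  proof -
    define i where "i = to_nat w"
    obtain q where q: "q > 0" and kill: "\<And>E''. E'' \<subseteq> ?E (Suc i) \<Longrightarrow> finite_group_congruence E''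
        \<Longrightarrow> has_orders E'' (?R (Suc i)) \<Longrightarrow> (wpow w q, []) \<in> E''"
      using S(2)[of i] unfolding Q_def i_def from_nat_to_nat by blast
    have late: "(wpow w q, []) \<in> ?E k" if "Suc i \<le> k" for k
      by (rule kill[OF decE[OF that] fgc])
        (use ord[of k] incR[OF that] in \<open>auto simp: has_orders_def\<close>)
    have "(wpow w q, []) \<in> ?E k" for k
    proof (cases "Suc i \<le> k")
      case False
      then show ?thesis using decE[of k "Suc i"] late[of "Suc i"] by auto
    qed (rule late)
    then show ?thesis using q by blast
  qed
  moreover have "?E (Suc k) \<subseteq> ?E k" "card (UNIV // ?E k) < card (UNIV // ?E (Suc k))"
    "cyclic_quotient (?E k) (?E (Suc k)) (F (card (UNIV // ?E k)) + 2)" for k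
    using S(2)[of k] by (simp_all add: Q_def)
  ultimately show ?thesis using fgc by (intro exI[of _ ?E]) simp
qed

section \<open>Finitely generated torsion groups have FAb\<close>

text \<open>Schreier's lemma. The map \<open>d\<close> returns to \<open>H\<close> along a transversal \<open>t\<close>; a product of generators
  of \<open>G\<close> is rewritten letter by letter, the corrections cancelling between consecutive
  letters. Since \<open>t H\<close> is some element of \<open>H\<close> and need not be the identity, it is included
  among the generators.\<close>

lemma (in group) finite_index_subgroup_finitely_generated:
  assumes fg: "finitely_generated G" and H: "finite_index H G"
  shows "\<exists>U. finite U \<and> U \<subseteq> H \<and> generate G U = H"
proof -
  obtain S where S: "finite S" "S \<subseteq> carrier G" "generate G S = carrier G"
    using fg by (auto simp: finitely_generated_def)
  have sub: "subgroup H G" and fin: "finite (rcosets H)" using H by (auto simp: finite_index_def)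
  interpret H: subgroup H G by fact
  have HG: "H \<subseteq> carrier G" by (rule H.subset)
  define t where "t C = (SOME x. x \<in> C)" for C :: "'a set"
  have t: "t (H #> x) \<in> H #> x" if "x \<in> carrier G" for x
    unfolding t_def by (rule someI, rule rcos_self[OF that sub])
  have tG: "t (H #> x) \<in> carrier G" if "x \<in> carrier G" for x
    using t[OF that] r_coset_subset_G[OF HG that] by blast
  have Ht: "H #> t (H #> x) = H #> x" if "x \<in> carrier G" for x
    using repr_independence[OF t[OF that] that sub] by (rule HOL.sym)
  have tC: "t C \<in> carrier G" "H #> t C = C" if "C \<in> rcosets H" for C
    using that tG Ht by (auto simp: RCOSETS_def)
  define d where "d x = x \<otimes> inv (t (H #> x))" for x
  have dH: "d x \<in> H" if x: "x \<in> carrier G" for x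
    unfolding d_def by (rule H.rcos_module_imp[OF is_group tG[OF x]])
      (simp add: Ht[OF x] rcos_self[OF x sub])
  have tH: "t H \<in> H" using t[OF one_closed] HG by simp
  define U where "U = insert (t H) ((\<lambda>(C, s). d (t C \<otimes> s)) ` ((rcosets H) \<times> (S \<union> m_inv G ` S)))"
  have finU: "finite U" unfolding U_def using fin S(1) by simp
  have SG: "s \<in> carrier G" if "s \<in> S \<union> m_inv G ` S" for s using that S(2) by auto
  have UH: "U \<subseteq> H" unfolding U_def using tH dH tC(1) SG by auto
  have gen: "\<forall>C\<in>rcosets H. d (t C \<otimes> g) \<in> generate G U" if "g \<in> generate G S" for g
    using that
  proof induction
    case one
    have "d (t C \<otimes> \<one>) = \<one>" if "C \<in> rcosets H" for C
      using tC[OF that] by (simp add: d_def)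
    then show ?case by (simp add: generate.one)
  next
    case (incl s)
    then show ?case by (auto simp: U_def intro!: generate.incl)
  next
    case (inv s)
    then show ?case by (auto simp: U_def intro!: generate.incl)
  next
    case (eng g1 g2)
    show ?case
    proof
      fix C assume C: "C \<in> rcosets H"
      have g: "g1 \<in> carrier G" "g2 \<in> carrier G" using eng.hyps S by auto
      note c = tC[OF C]
      let ?C = "H #> (t C \<otimes> g1)"
      have x: "t C \<otimes> g1 \<in> carrier G" using c g by simp
      then have C': "?C \<in> rcosets H" by (rule rcosetsI[OF HG])
      note c' = tC[OF C']
      have "H #> (t ?C \<otimes> g2) = H #> (t C \<otimes> g1 \<otimes> g2)"
        using coset_mult_assoc[OF HG c'(1) g(2)] coset_mult_assoc[OF HG x g(2)] c'(2) by simp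
      then have "d (t C \<otimes> (g1 \<otimes> g2)) = t C \<otimes> g1 \<otimes> g2 \<otimes> inv (t (H #> (t ?C \<otimes> g2)))"
        using c g by (simp add: d_def m_assoc)
      also have "\<dots> = d (t C \<otimes> g1) \<otimes> d (t ?C \<otimes> g2)"
      proof -
        have "t (H #> (t ?C \<otimes> g2)) \<in> carrier G" using c' g by (intro tG) simp
        moreover have "inv t ?C \<otimes> (t ?C \<otimes> z) = z" if "z \<in> carrier G" for z
          using that c' by (simp flip: m_assoc)
        ultimately show ?thesis using c c' g x by (simp add: d_def m_assoc)
      qed
      finally show "d (t C \<otimes> (g1 \<otimes> g2)) \<in> generate G U"
        using eng.IH C C' by (simp add: generate.eng)
    qed
  qed
  have "h \<in> generate G U" if h: "h \<in> H" for h
  proof -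
    have hG: "h \<in> carrier G" "t H \<in> carrier G" using h tH HG by auto
    have "H \<in> rcosets H" using rcosetsI[OF HG one_closed] HG by simp
    then have "d (t H \<otimes> h) \<in> generate G U" using gen[of h] hG(1) S(3) by simp
    moreover have "H #> (t H \<otimes> h) = H" using h tH by (intro H.rcos_const is_group) simp
    ultimately have "t H \<otimes> h \<otimes> inv (t H) \<in> generate G U" by (simp add: d_def)
    moreover have "t H \<in> generate G U" "inv (t H) \<in> generate G U"
      by (auto simp: U_def intro: generate.incl generate.inv)
    ultimately have "inv (t H) \<otimes> (t H \<otimes> h \<otimes> inv (t H)) \<otimes> t H \<in> generate G U"
      by (meson generate.eng)
    moreover have "inv (t H) \<otimes> (t H \<otimes> h \<otimes> inv (t H)) \<otimes> t H = h"
      using hG by (simp add: m_assoc) (simp flip: m_assoc)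
    ultimately show ?thesis by simp
  qed
  then have "generate G U = H" using generate_subgroup_incl[OF UH sub] by blast
  then show ?thesis using finU UH by blast
qed

lemma (in comm_group) finite_generate_torsion:
  assumes "finite S" "S \<subseteq> carrier G" "\<And>s. s \<in> S \<Longrightarrow> \<exists>q>0. s [^] (q::nat) = \<one>"
  shows "finite (generate G S)"
  using assms
proof (induction S)
  case empty
  have "generate G {} \<subseteq> {\<one>}" by (rule generate_subgroup_incl) (simp_all add: triv_subgroup)
  then show ?case by (rule finite_subset) simp
next
  case (insert a S)
  let ?B = "generate G S"
  have B: "subgroup ?B G" by (rule generate_is_subgroup) (use insert.prems in auto)
  then interpret B: subgroup ?B G .
  have aG: "a \<in> carrier G" using insert.prems by auto
  obtain q :: nat where q: "q > 0" "a [^] q = \<one>" using insert.prems(2) by auto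
  have mod: "a [^] i = a [^] (i mod q)" for i :: nat
  proof -
    have "a [^] i = (a [^] q) [^] (i div q) \<otimes> a [^] (i mod q)"
      using aG by (simp add: nat_pow_pow nat_pow_mult)
    then show ?thesis using aG q by simp
  qed
  let ?P = "(\<lambda>(i, b). a [^] i \<otimes> b) ` ({..<q} \<times> ?B)"
  have memP: "a [^] (i::nat) \<otimes> b \<in> ?P" if "b \<in> ?B" for i b
    using that q mod[of i] by (intro image_eqI[of _ _ "(i mod q, b)"]) auto
  have "generate G (insert a S) \<subseteq> ?P"
  proof
    fix x assume "x \<in> generate G (insert a S)"
    then show "x \<in> ?P"
    proof induction
      case one
      show ?case using memP[of \<one> 0] by simp
    next
      case (incl x)
      show ?case
      proof (cases "x = a")
        case True
        then show ?thesis using memP[of \<one> 1] aG by simp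
      next
        case False
        then have "x \<in> ?B" using incl by (auto intro: generate.incl)
        then show ?thesis using memP[of x 0] B.mem_carrier by simp
      qed
    next
      case (inv x)
      show ?case
      proof (cases "x = a")
        case True
        have "a [^] (q - 1) \<otimes> a = \<one>" using q aG by (simp flip: nat_pow_Suc)
        then have "inv a = a [^] (q - 1)" using aG by (simp add: inv_equality)
        then show ?thesis using memP[of \<one> "q - 1"] True aG by simp
      next
        case False
        then have "inv x \<in> ?B" using inv by (auto intro: generate.inv)
        then show ?thesis using memP[of "inv x" 0] B.mem_carrier by simp
      qed
    next
      case (eng x y)
      then obtain i j b c where *: "x = a [^] (i::nat) \<otimes> b" "y = a [^] (j::nat) \<otimes> c" "b \<in> ?B" "c \<in> ?B"
        by auto
      then have "b \<in> carrier G" "c \<in> carrier G" by (auto dest: B.mem_carrier)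
      then have "x \<otimes> y = a [^] (i + j) \<otimes> (b \<otimes> c)"
        using * aG by (simp add: m_ac flip: nat_pow_mult)
      then show ?case using memP[of "b \<otimes> c" "i + j"] * by simp
    qed
  qed
  moreover have "finite ?P" using insert by simp
  ultimately show ?case by (rule finite_subset)
qed

lemma (in group) FAb_of_finitely_generated_torsion:
  assumes fg: "finitely_generated G"
    and torsion: "\<And>g. g \<in> carrier G \<Longrightarrow> \<exists>q>0. g [^] (q::nat) = \<one>"
  shows "FAb G"
  unfolding FAb_def
proof (intro allI impI)
  fix H assume H: "finite_index H G"
  then have sub: "subgroup H G" by (simp add: finite_index_def)
  obtain U where U: "finite U" "U \<subseteq> H" "generate G U = H"
    using finite_index_subgroup_finitely_generated[OF fg H] by blast
  let ?K = "G\<lparr>carrier := H\<rparr>" and ?D = "derived G H"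
  interpret K: group ?K by (rule subgroup_imp_group[OF sub])
  have D: "derived ?K (carrier ?K) = ?D" using derived_consistent[OF _ sub] by simp
  interpret D: normal ?D ?K by (rule derived_subgroup_is_normal[OF sub])
  interpret A: comm_group "abelianization H G"
    unfolding abelianization_def using K.derived_quot_is_comm_group unfolding D .
  let ?f = "\<lambda>h. ?D #>\<^bsub>?K\<^esub> h"
  interpret f: group_hom ?K "abelianization H G" ?f
    by unfold_locales (use D.r_coset_hom_Mod in \<open>simp add: abelianization_def\<close>)
  have "generate (abelianization H G) (?f ` U) = ?f ` generate ?K U"
    by (rule f.generate_img) (use U in simp)
  also have "generate ?K U = H" using generate_consistent[OF U(2) sub] U(3) by simp
  also have "?f ` H = carrier (abelianization H G)"
    by (auto simp: abelianization_def FactGroup_def RCOSETS_def)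
  finally have gen: "generate (abelianization H G) (?f ` U) = carrier (abelianization H G)" .
  have "finite (generate (abelianization H G) (?f ` U))"
  proof (rule A.finite_generate_torsion)
    show "finite (?f ` U)" using U by simp
    show "?f ` U \<subseteq> carrier (abelianization H G)"
      using U(2) f.hom_closed by auto
    fix s assume "s \<in> ?f ` U"
    then obtain u where u: "u \<in> U" "s = ?f u" by blast
    then have uH: "u \<in> H" using U by blast
    then obtain q :: nat where q: "q > 0" "u [^] q = \<one>"
      using torsion sub subgroup.mem_carrier by metis
    have "s [^]\<^bsub>abelianization H G\<^esub> q = ?f (u [^]\<^bsub>?K\<^esub> q)"
      unfolding u(2) using f.hom_nat_pow[of u q] uH by simp
    also have "u [^]\<^bsub>?K\<^esub> q = \<one>\<^bsub>?K\<^esub>" using q by (simp add: nat_pow_consistent[symmetric])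
    also have "?f \<one>\<^bsub>?K\<^esub> = \<one>\<^bsub>abelianization H G\<^esub>" by (rule f.hom_one)
    finally show "\<exists>q>0. s [^]\<^bsub>abelianization H G\<^esub> (q::nat) = \<one>\<^bsub>abelianization H G\<^esub>"
      using q(1) by blast
  qed
  then show "finite (carrier (abelianization H G))" unfolding gen .
qed

text \<open>A character of \<open>N\<close> factors through \<open>N/N'\<close>, so its values bound the order of \<open>N/N'\<close> from below.\<close>

lemma (in group) ab_ge_of_character:
  fixes \<theta> :: "'a \<Rightarrow> 'c::field"
  assumes N: "subgroup N G" and index: "ecard (rcosets N) \<le> enat n"
    and mult: "\<And>x y. x \<in> N \<Longrightarrow> y \<in> N \<Longrightarrow> \<theta> (x \<otimes> y) = \<theta> x * \<theta> y"
    and nonzero: "\<And>x. x \<in> N \<Longrightarrow> \<theta> x \<noteq> 0"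
    and X: "X \<subseteq> \<theta> ` N"
  shows "ecard X \<le> ab n G"
proof -
  interpret N: subgroup N G by fact
  let ?K = "G\<lparr>carrier := N\<rparr>" and ?D = "derived G N"
  have one: "\<theta> \<one> = 1" using mult[of \<one> \<one>] nonzero[of \<one>] by simp
  have inv: "\<theta> (inv x) = inverse (\<theta> x)" if "x \<in> N" for x
  proof -
    have "\<theta> x * \<theta> (inv x) = \<theta> (x \<otimes> inv x)" using that by (intro mult[symmetric]) auto
    also have "\<dots> = 1" using one N.mem_carrier[OF that] by simp
    finally show ?thesis by (rule inverse_unique[symmetric])
  qed
  have DN: "?D \<subseteq> N" by (rule derived_incl[OF subset_refl N])
  have "\<theta> c = 1" if "c \<in> ?D" for c
  proof -
    have sub: "subgroup {x \<in> N. \<theta> x = 1} G"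
    proof (rule subgroupI)
      show "{x \<in> N. \<theta> x = 1} \<noteq> {}" using one N.one_closed by blast
    qed (use one inv mult N.mem_carrier in auto)
    have "derived_set G N \<subseteq> {x \<in> N. \<theta> x = 1}"
    proof
      fix c assume "c \<in> derived_set G N"
      then obtain x y where "x \<in> N" "y \<in> N" "c = x \<otimes> y \<otimes> inv x \<otimes> inv y" by auto
      then show "c \<in> {x \<in> N. \<theta> x = 1}" by (simp add: mult inv nonzero field_simps)
    qed
    then show ?thesis using generate_subgroup_incl[OF _ sub] that unfolding derived_def by blast
  qed
  then have const: "\<theta> y = \<theta> x" if "x \<in> N" "y \<in> ?D #> x" for x y
    using that mult DN by (auto simp: r_coset_def)
  define f where "f C = \<theta> (SOME x. x \<in> C)" for C
  have D: "subgroup ?D G" by (rule derived_is_subgroup[OF N.subset])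
  have f: "f (?D #> x) = \<theta> x" if "x \<in> N" for x
    unfolding f_def
    by (rule const[OF that], rule someI, rule rcos_self[OF N.mem_carrier[OF that] D])
  let ?A = "carrier (abelianization N G)"
  have "X \<subseteq> f ` ?A"
  proof
    fix z assume "z \<in> X"
    then obtain x where x: "x \<in> N" "z = \<theta> x" using X by blast
    then have "?D #> x \<in> ?A"
      by (auto simp: abelianization_def FactGroup_def RCOSETS_def)
    then show "z \<in> f ` ?A" using f x by (metis image_eqI)
  qed
  then have "ecard X \<le> ecard ?A"
    unfolding ecard_def by (auto intro: finite_subset surj_card_le finite_surj)
  also have "\<dots> \<le> ab n G"
    unfolding ab_def using N index by (intro SUP_upper) simp
  finally show ?thesis .
qed

section \<open>Irreducible quotients of a representation\<close>

lemma mat_eq_if_mult_vec_eq: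
  fixes A B :: "'a::semiring_1 mat"
  assumes "A \<in> carrier_mat r c" "B \<in> carrier_mat r c"
    and eq: "\<And>v. v \<in> carrier_vec c \<Longrightarrow> A *\<^sub>v v = B *\<^sub>v v"
  shows "A = B"
proof (rule eq_matI)
  fix i j assume "i < dim_row B" "j < dim_col B"
  then have ij: "i < r" "j < c" using assms by auto
  have entry: "M $$ (i, j) = (M *\<^sub>v unit_vec c j) $ i" if "M \<in> carrier_mat r c" for M :: "'a mat"
    using that ij by simp
  show "A $$ (i, j) = B $$ (i, j)"
    unfolding entry[OF assms(1)] entry[OF assms(2)] using eq[OF unit_vec_carrier] by simp
qed (use assms in auto)

text \<open>Use the coordinate \<open>i\<close> with \<open>u $ i \<noteq> 0\<close> to subtract from \<open>x\<close> the multiple of \<open>u\<close> that kills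
  \<open>x $ i\<close>, then drop this coordinate. The other coordinates are enumerated by \<open>skip\<close>.\<close>

lemma exists_quotient_of_line:
  fixes u :: "'a::field vec"
  assumes u: "u \<in> carrier_vec (Suc e)" "u \<noteq> 0\<^sub>v (Suc e)"
  shows "\<exists>Q R. Q \<in> carrier_mat e (Suc e) \<and> R \<in> carrier_mat (Suc e) e \<and> Q * R = 1\<^sub>m e
     \<and> (\<forall>x \<in> carrier_vec (Suc e). Q *\<^sub>v x = 0\<^sub>v e \<longrightarrow> (\<exists>c. x = c \<cdot>\<^sub>v u))"
proof -
  obtain i where i: "i < Suc e" "u $ i \<noteq> 0"
    using u by (metis carrier_vecD eq_vecI index_zero_vec)
  define skip where "skip a = (if a < i then a else Suc a)" for a :: nat
  have skip_ne: "skip a \<noteq> i" for a by (simp add: skip_def)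
  have skip_less: "skip a < Suc e" if "a < e" for a using that i by (auto simp: skip_def)
  have skip_inj: "skip a = skip b \<longleftrightarrow> a = b" for a b by (auto simp: skip_def)
  have skip_surj: "\<exists>a<e. b = skip a" if b: "b < Suc e" "b \<noteq> i" for b
  proof (cases "b < i")
    case True
    then show ?thesis using i by (intro exI[of _ b]) (auto simp: skip_def)
  next
    case False
    then show ?thesis using b by (intro exI[of _ "b - 1"]) (auto simp: skip_def)
  qed
  define Q where "Q = mat e (Suc e) (\<lambda>(a, b). if b = skip a then 1 else if b = i then - (u $ skip a) / u $ i else 0)"
  define R where "R = mat (Suc e) e (\<lambda>(b, a). if b = skip a then 1 else (0::'a))"
  have QR: "Q \<in> carrier_mat e (Suc e)" "R \<in> carrier_mat (Suc e) e" by (simp_all add: Q_def R_def)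
  have Q_mult: "(Q *\<^sub>v x) $ a = x $ skip a - u $ skip a / u $ i * x $ i"
    if a: "a < e" and x: "x \<in> carrier_vec (Suc e)" for a x
  proof -
    have "(Q *\<^sub>v x) $ a = (\<Sum>b = 0..<Suc e. Q $$ (a, b) * x $ b)"
      using a x QR by (auto simp: scalar_prod_def intro!: sum.cong)
    also have "\<dots> = (\<Sum>b = 0..<Suc e. (if b = skip a then x $ b else 0)
        + (if b = i then - (u $ skip a) / u $ i * x $ b else 0))"
      using a skip_ne[of a] by (intro sum.cong refl) (auto simp: Q_def)
    also have "\<dots> = x $ skip a - u $ skip a / u $ i * x $ i"
      unfolding sum.distrib sum.delta'[OF finite_atLeastLessThan] using skip_less[OF a] i by simp
    finally show ?thesis .
  qed
  have "Q * R = 1\<^sub>m e"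
  proof (rule eq_matI)
    fix a b assume "a < dim_row (1\<^sub>m e :: 'a mat)" "b < dim_col (1\<^sub>m e :: 'a mat)"
    then have ab: "a < e" "b < e" by auto
    have "(Q * R) $$ (a, b) = (Q *\<^sub>v col R b) $ a" using ab QR by simp
    also have "\<dots> = col R b $ skip a - u $ skip a / u $ i * col R b $ i"
      by (rule Q_mult[OF ab(1)]) (use QR ab in simp)
    also have "\<dots> = 1\<^sub>m e $$ (a, b)"
      using ab skip_less[OF ab(1)] skip_ne[of b] i(1) by (auto simp: R_def skip_inj)
    finally show "(Q * R) $$ (a, b) = 1\<^sub>m e $$ (a, b)" .
  qed (use QR in auto)
  moreover have "\<exists>c. x = c \<cdot>\<^sub>v u" if x: "x \<in> carrier_vec (Suc e)" and Qx: "Q *\<^sub>v x = 0\<^sub>v e" for x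
  proof (intro exI eq_vecI)
    fix b assume "b < dim_vec ((x $ i / u $ i) \<cdot>\<^sub>v u)"
    then have b: "b < Suc e" using u by simp
    show "x $ b = ((x $ i / u $ i) \<cdot>\<^sub>v u) $ b"
    proof (cases "b = i")
      case True
      then show ?thesis using b u i by simp
    next
      case False
      then obtain a where a: "a < e" "b = skip a" using skip_surj b by blast
      have "(Q *\<^sub>v x) $ a = 0" using Qx a by simp
      then show ?thesis using Q_mult[OF a(1) x] a b u by simp
    qed
  qed (use x u in simp)
  ultimately show ?thesis using QR by blast
qed

text \<open>Among the surjections with kernel inside \<open>W\<close> take one of smallest rank. Its kernel is all of
  \<open>W\<close>, for otherwise the image of a further vector of \<open>W\<close> spans a line, and dividing by that
  line gives a smaller surjection. A right inverse \<open>R\<close> is carried along as the certificate of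
  surjectivity.\<close>

lemma exists_quotient_by_subspace:
  fixes W :: "'a::field vec set"
  assumes W: "W \<subseteq> carrier_vec d" "0\<^sub>v d \<in> W" "W \<noteq> {0\<^sub>v d}" "W \<noteq> carrier_vec d"
    and add: "\<And>v w. v \<in> W \<Longrightarrow> w \<in> W \<Longrightarrow> v + w \<in> W"
    and smult: "\<And>c v. v \<in> W \<Longrightarrow> c \<cdot>\<^sub>v v \<in> W"
  shows "\<exists>e Q R. 1 \<le> e \<and> e < d \<and> Q \<in> carrier_mat e d \<and> R \<in> carrier_mat d e \<and> Q * R = 1\<^sub>m e
           \<and> (\<forall>v \<in> carrier_vec d. Q *\<^sub>v v = 0\<^sub>v e \<longleftrightarrow> v \<in> W)"
proof -
  define admissible where "admissible e Q R \<longleftrightarrow> Q \<in> carrier_mat e d \<and> R \<in> carrier_mat d e \<and> Q * R = 1\<^sub>m e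
      \<and> (\<forall>v \<in> carrier_vec d. Q *\<^sub>v v = 0\<^sub>v e \<longrightarrow> v \<in> W)" for e and Q R :: "'a mat"
  have start: "admissible d (1\<^sub>m d) (1\<^sub>m d)" using W(2) by (auto simp: admissible_def)
  define e where "e = (LEAST e. \<exists>Q R. admissible e Q R)"
  have "\<exists>Q R. admissible e Q R" unfolding e_def by (rule LeastI_ex) (use start in blast)
  then obtain Q R where QR: "Q \<in> carrier_mat e d" "R \<in> carrier_mat d e" "Q * R = 1\<^sub>m e"
    and ker: "\<And>v. v \<in> carrier_vec d \<Longrightarrow> Q *\<^sub>v v = 0\<^sub>v e \<Longrightarrow> v \<in> W"
    unfolding admissible_def by blast
  have "e \<le> d" unfolding e_def by (rule Least_le) (use start in blast)
  have kerW: "Q *\<^sub>v w = 0\<^sub>v e" if w: "w \<in> W" for w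
  proof (rule ccontr)
    assume ne: "Q *\<^sub>v w \<noteq> 0\<^sub>v e"
    have wc: "w \<in> carrier_vec d" using w W by blast
    have Qw: "Q *\<^sub>v w \<in> carrier_vec e" by (rule mult_mat_vec_carrier[OF QR(1) wc])
    have "e \<noteq> 0"
    proof
      assume "e = 0"
      then have "Q *\<^sub>v w = 0\<^sub>v e" by (intro eq_vecI) (use QR in simp_all)
      then show False using ne by simp
    qed
    then obtain e' where e': "e = Suc e'" using not0_implies_Suc by blast
    obtain Q2 R2 where Q2: "Q2 \<in> carrier_mat e' e" "R2 \<in> carrier_mat e e'" "Q2 * R2 = 1\<^sub>m e'"
      and ker2: "\<And>x. x \<in> carrier_vec e \<Longrightarrow> Q2 *\<^sub>v x = 0\<^sub>v e' \<Longrightarrow> \<exists>c. x = c \<cdot>\<^sub>v (Q *\<^sub>v w)"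
      using exists_quotient_of_line[of "Q *\<^sub>v w" e'] Qw ne unfolding e' by blast
    have "(Q2 * Q) * (R * R2) = Q2 * (Q * (R * R2))"
      by (rule assoc_mult_mat[OF Q2(1) QR(1) mult_carrier_mat[OF QR(2) Q2(2)]])
    also have "Q * (R * R2) = (Q * R) * R2"
      by (rule assoc_mult_mat[symmetric, OF QR(1,2) Q2(2)])
    finally have "(Q2 * Q) * (R * R2) = 1\<^sub>m e'" using Q2 QR by simp
    moreover have "v \<in> W" if v: "v \<in> carrier_vec d" and "(Q2 * Q) *\<^sub>v v = 0\<^sub>v e'" for v
    proof -
      have Qv: "Q *\<^sub>v v \<in> carrier_vec e" by (rule mult_mat_vec_carrier[OF QR(1) v])
      have "Q2 *\<^sub>v (Q *\<^sub>v v) = 0\<^sub>v e'"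
        using that(2) assoc_mult_mat_vec[OF Q2(1) QR(1) v] by simp
      then obtain c where c: "Q *\<^sub>v v = c \<cdot>\<^sub>v (Q *\<^sub>v w)" using ker2[OF Qv] by blast
      have "Q *\<^sub>v (v + (- c) \<cdot>\<^sub>v w) = Q *\<^sub>v v + (- c) \<cdot>\<^sub>v (Q *\<^sub>v w)"
        using QR(1) v wc by (simp add: mult_add_distrib_mat_vec[of _ e d] mult_mat_vec[of _ e d])
      also have "\<dots> = 0\<^sub>v e"
      proof -
        have "c \<cdot>\<^sub>v u + (- c) \<cdot>\<^sub>v u = 0\<^sub>v e" if "u \<in> carrier_vec e" for u
          by (rule eq_vecI) (use that in auto)
        then show ?thesis unfolding c using Qw by blast
      qed
      finally have "v + (- c) \<cdot>\<^sub>v w \<in> W" using v wc by (intro ker) auto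
      then have "(v + (- c) \<cdot>\<^sub>v w) + c \<cdot>\<^sub>v w \<in> W"
        by (rule add[OF _ smult[OF w]])
      also have "(v + (- c) \<cdot>\<^sub>v w) + c \<cdot>\<^sub>v w = v" using v wc by (intro eq_vecI) auto
      finally show "v \<in> W" .
    qed
    ultimately have "admissible e' (Q2 * Q) (R * R2)"
      unfolding admissible_def using Q2 QR by auto
    then have "e \<le> e'" unfolding e_def by (intro Least_le) blast
    then show False using e' by simp
  qed
  have "e \<noteq> 0"
  proof
    assume "e = 0"
    have "v \<in> W" if "v \<in> carrier_vec d" for v
      by (rule ker[OF that], rule eq_vecI) (use QR(1) \<open>e = 0\<close> in simp_all)
    then show False using W by blast
  qed
  moreover have "e \<noteq> d"
  proof
    assume "e = d"
    then have "R * Q = 1\<^sub>m d" using QR mat_mult_left_right_inverse by blast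
    have "w = 0\<^sub>v d" if w: "w \<in> W" for w
    proof -
      have wc: "w \<in> carrier_vec d" using w W by blast
      have "w = (R * Q) *\<^sub>v w" unfolding \<open>R * Q = 1\<^sub>m d\<close> using wc by simp
      also have "\<dots> = R *\<^sub>v 0\<^sub>v e"
        unfolding assoc_mult_mat_vec[OF QR(2,1) wc] kerW[OF w] ..
      also have "\<dots> = 0\<^sub>v d" using QR(2) by (intro eq_vecI) auto
      finally show ?thesis .
    qed
    then show False using W(2,3) by blast
  qed
  ultimately show ?thesis using \<open>e \<le> d\<close> QR ker kerW
    by (intro exI[of _ e] exI[of _ Q] exI[of _ R]) auto
qed

lemma carrier_GL:
  "carrier (GL d) = {A \<in> carrier_mat d d. \<exists>B \<in> carrier_mat d d. B * A = 1\<^sub>m d \<and> A * B = 1\<^sub>m d}"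
  by (simp add: GL_def units_of_def Units_def ring_mat_def)

lemma mult_GL [simp]: "A \<otimes>\<^bsub>GL d\<^esub> B = A * B"
  by (simp add: GL_def units_of_def ring_mat_def)

lemma one_GL [simp]: "\<one>\<^bsub>GL d\<^esub> = 1\<^sub>m d"
  by (simp add: GL_def units_of_def ring_mat_def)

lemma group_GL: "group (GL d)"
proof -
  interpret ring "ring_mat TYPE(complex) d ()" by (rule ring_mat)
  show ?thesis unfolding GL_def by (rule units_group)
qed

lemma (in group) hom_GL_I:
  assumes car: "\<And>x. x \<in> carrier G \<Longrightarrow> \<sigma> x \<in> carrier_mat d d"
    and mult: "\<And>x y. x \<in> carrier G \<Longrightarrow> y \<in> carrier G \<Longrightarrow> \<sigma> (x \<otimes> y) = \<sigma> x * \<sigma> y"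
    and one: "\<sigma> \<one> = 1\<^sub>m d"
  shows "\<sigma> \<in> hom G (GL d)"
proof (rule homI)
  fix x assume x: "x \<in> carrier G"
  have "\<sigma> (inv x) * \<sigma> x = 1\<^sub>m d" "\<sigma> x * \<sigma> (inv x) = 1\<^sub>m d"
    using mult[of "inv x" x] mult[of x "inv x"] x one by simp_all
  then show "\<sigma> x \<in> carrier (GL d)"
    unfolding carrier_GL using car[OF x] car[OF inv_closed[OF x]] by blast
qed (simp add: mult)

lemma (in group) hom_GL_D:
  assumes "\<sigma> \<in> hom G (GL d)"
  shows "\<And>x. x \<in> carrier G \<Longrightarrow> \<sigma> x \<in> carrier_mat d d"
    and "\<And>x y. x \<in> carrier G \<Longrightarrow> y \<in> carrier G \<Longrightarrow> \<sigma> (x \<otimes> y) = \<sigma> x * \<sigma> y"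
    and "\<sigma> \<one> = 1\<^sub>m d"
proof -
  show "\<sigma> x \<in> carrier_mat d d" if "x \<in> carrier G" for x
    using hom_in_carrier[OF assms that] by (simp add: carrier_GL)
  show "\<sigma> (x \<otimes> y) = \<sigma> x * \<sigma> y" if "x \<in> carrier G" "y \<in> carrier G" for x y
    using hom_mult[OF assms that] by simp
  show "\<sigma> \<one> = 1\<^sub>m d"
    using hom_one[OF assms is_group group_GL] by simp
qed

lemma subspace_closed:
  assumes "VectorSpace.subspace class_ring W (module_vec TYPE('a::field) d)"
  shows "W \<subseteq> carrier_vec d" "0\<^sub>v d \<in> W" "\<And>v w. v \<in> W \<Longrightarrow> w \<in> W \<Longrightarrow> v + w \<in> W"
    "\<And>c v. v \<in> W \<Longrightarrow> c \<cdot>\<^sub>v v \<in> W"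
proof -
  interpret submodule class_ring W "module_vec TYPE('a) d"
    using assms by (simp add: VectorSpace.subspace_def)
  show "W \<subseteq> carrier_vec d" using subset by (simp add: module_vec_simps)
  show "0\<^sub>v d \<in> W" using zero_closed by (simp add: module_vec_simps)
  show "v + w \<in> W" if "v \<in> W" "w \<in> W" for v w
    using m_closed[OF that] by (simp add: module_vec_simps)
  show "c \<cdot>\<^sub>v v \<in> W" if "v \<in> W" for c v
    using smult_closed[of c v] that by (simp add: module_vec_simps class_ring_simps)
qed

text \<open>\<open>P\<close> is the surjective intertwiner and \<open>R\<close> a linear section of it.\<close>

definition quotient_rep ::
  "('a, 'b) monoid_scheme \<Rightarrow> nat \<Rightarrow> ('a \<Rightarrow> complex mat) \<Rightarrow> nat \<Rightarrow> ('a \<Rightarrow> complex mat) \<Rightarrow>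
     complex mat \<Rightarrow> complex mat \<Rightarrow> bool" where
  "quotient_rep G n \<rho> e \<sigma> P R \<longleftrightarrow> \<sigma> \<in> hom G (GL e) \<and> P \<in> carrier_mat e n \<and> R \<in> carrier_mat n e
     \<and> P * R = 1\<^sub>m e \<and> (\<forall>g \<in> carrier G. P * \<rho> g = \<sigma> g * P)"

lemma (in group) quotient_rep_trans:
  assumes 1: "quotient_rep G n \<rho> e \<sigma> P R" and 2: "quotient_rep G e \<sigma> d \<tau> Q S"
    and \<rho>: "\<rho> \<in> hom G (GL n)"
  shows "quotient_rep G n \<rho> d \<tau> (Q * P) (R * S)"
proof -
  have c: "P \<in> carrier_mat e n" "R \<in> carrier_mat n e" "Q \<in> carrier_mat d e" "S \<in> carrier_mat e d"
    "P * R = 1\<^sub>m e" "Q * S = 1\<^sub>m d" "\<sigma> \<in> hom G (GL e)" "\<tau> \<in> hom G (GL d)"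
    using 1 2 by (auto simp: quotient_rep_def)
  have "(Q * P) * (R * S) = Q * (P * (R * S))"
    by (rule assoc_mult_mat[OF c(3) c(1) mult_carrier_mat[OF c(2,4)]])
  also have "P * (R * S) = (P * R) * S" by (rule assoc_mult_mat[symmetric, OF c(1,2,4)])
  also have "\<dots> = S" using c by simp
  finally have "(Q * P) * (R * S) = 1\<^sub>m d" using c by simp
  moreover have "(Q * P) * \<rho> g = \<tau> g * (Q * P)" if g: "g \<in> carrier G" for g
  proof -
    note m = hom_GL_D(1)[OF \<rho> g] hom_GL_D(1)[OF c(7) g] hom_GL_D(1)[OF c(8) g]
    have "(Q * P) * \<rho> g = Q * (P * \<rho> g)" by (rule assoc_mult_mat[OF c(3,1) m(1)])
    also have "P * \<rho> g = \<sigma> g * P" using 1 g by (simp add: quotient_rep_def)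
    also have "Q * (\<sigma> g * P) = (Q * \<sigma> g) * P" by (rule assoc_mult_mat[symmetric, OF c(3) m(2) c(1)])
    also have "Q * \<sigma> g = \<tau> g * Q" using 2 g by (simp add: quotient_rep_def)
    also have "(\<tau> g * Q) * P = \<tau> g * (Q * P)" by (rule assoc_mult_mat[OF m(3) c(3,1)])
    finally show ?thesis .
  qed
  ultimately show ?thesis
    unfolding quotient_rep_def using c(8) mult_carrier_mat[OF c(3,1)] mult_carrier_mat[OF c(2,4)]
    by blast
qed

text \<open>The action on \<open>\<complex>\<^sup>e/W\<close> is \<open>Q \<sigma> S\<close>. It commutes with \<open>Q\<close> because \<open>v - S Q v\<close> lies in \<open>W\<close>, hence
  so does its image under \<open>\<sigma> g\<close>.\<close>

lemma (in group) exists_quotient_rep_by_invariant_subspace: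
  assumes \<sigma>: "\<sigma> \<in> hom G (GL e)"
    and W: "VectorSpace.subspace class_ring W (module_vec TYPE(complex) e)"
      "W \<noteq> {0\<^sub>v e}" "W \<noteq> carrier_vec e"
    and inv: "\<And>g w. g \<in> carrier G \<Longrightarrow> w \<in> W \<Longrightarrow> \<sigma> g *\<^sub>v w \<in> W"
  shows "\<exists>d \<tau> Q S. 1 \<le> d \<and> d < e \<and> quotient_rep G e \<sigma> d \<tau> Q S"
proof -
  note cl = subspace_closed[OF W(1)]
  obtain d Q S where d: "1 \<le> d" "d < e" and Q: "Q \<in> carrier_mat d e" and S: "S \<in> carrier_mat e d"
    and QS: "Q * S = 1\<^sub>m d" and ker: "\<forall>v \<in> carrier_vec e. Q *\<^sub>v v = 0\<^sub>v d \<longleftrightarrow> v \<in> W"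
    using exists_quotient_by_subspace[OF cl(1,2) W(2,3) cl(3,4)] by blast
  define \<tau> where "\<tau> g = Q * (\<sigma> g * S)" for g
  note m = hom_GL_D(1)[OF \<sigma>]
  have \<tau>c: "\<tau> g \<in> carrier_mat d d" if "g \<in> carrier G" for g
    unfolding \<tau>_def by (rule mult_carrier_mat[OF Q mult_carrier_mat[OF m[OF that] S]])
  have comm: "Q * \<sigma> g = \<tau> g * Q" if g: "g \<in> carrier G" for g
  proof (rule mat_eq_if_mult_vec_eq)
    show "Q * \<sigma> g \<in> carrier_mat d e" by (rule mult_carrier_mat[OF Q m[OF g]])
    show "\<tau> g * Q \<in> carrier_mat d e" by (rule mult_carrier_mat[OF \<tau>c[OF g] Q])
    fix v :: "complex vec" assume v: "v \<in> carrier_vec e"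
    have Qv: "Q *\<^sub>v v \<in> carrier_vec d" by (rule mult_mat_vec_carrier[OF Q v])
    define u where "u = S *\<^sub>v (Q *\<^sub>v v)"
    have u: "u \<in> carrier_vec e" unfolding u_def by (rule mult_mat_vec_carrier[OF S Qv])
    have \<sigma>c: "\<sigma> g *\<^sub>v x \<in> carrier_vec e" if "x \<in> carrier_vec e" for x
      by (rule mult_mat_vec_carrier[OF m[OF g] that])
    have "Q *\<^sub>v u = (Q * S) *\<^sub>v (Q *\<^sub>v v)"
      unfolding u_def by (rule assoc_mult_mat_vec[symmetric, OF Q S Qv])
    also have "\<dots> = Q *\<^sub>v v" unfolding QS using Qv by simp
    finally have "Q *\<^sub>v (v - u) = 0\<^sub>v d"
      using mult_minus_distrib_mat_vec[OF Q v u] Qv by simp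
    then have "v - u \<in> W" using ker v u by simp
    then have "\<sigma> g *\<^sub>v (v - u) \<in> W" by (rule inv[OF g])
    then have "Q *\<^sub>v (\<sigma> g *\<^sub>v (v - u)) = 0\<^sub>v d"
      using ker \<sigma>c[of "v - u"] v u by simp
    then have z: "Q *\<^sub>v (\<sigma> g *\<^sub>v v) - Q *\<^sub>v (\<sigma> g *\<^sub>v u) = 0\<^sub>v d"
      by (simp add: mult_minus_distrib_mat_vec[OF m[OF g] v u] mult_minus_distrib_mat_vec[OF Q \<sigma>c[OF v] \<sigma>c[OF u]])
    have dim: "Q *\<^sub>v (\<sigma> g *\<^sub>v v) \<in> carrier_vec d" "Q *\<^sub>v (\<sigma> g *\<^sub>v u) \<in> carrier_vec d"
      using mult_mat_vec_carrier[OF Q \<sigma>c] u v by blast+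
    have "x = y" if "x - y = 0\<^sub>v d" "x \<in> carrier_vec d" "y \<in> carrier_vec d" for x y :: "complex vec"
    proof (rule eq_vecI)
      fix i assume "i < dim_vec y"
      then have i: "i < d" using that(3) by simp
      have "x $ i - y $ i = (x - y) $ i" using i that(2,3) by simp
      also have "\<dots> = 0" unfolding that(1) using i by simp
      finally show "x $ i = y $ i" by simp
    qed (use that in simp)
    from this[OF z dim] have "Q *\<^sub>v (\<sigma> g *\<^sub>v v) = Q *\<^sub>v (\<sigma> g *\<^sub>v u)" .
    also have "\<dots> = \<tau> g *\<^sub>v (Q *\<^sub>v v)"
      unfolding u_def \<tau>_def
      by (simp add: assoc_mult_mat_vec[OF Q mult_carrier_mat[OF m[OF g] S] Qv]
          assoc_mult_mat_vec[OF m[OF g] S Qv])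
    finally show "(Q * \<sigma> g) *\<^sub>v v = (\<tau> g * Q) *\<^sub>v v"
      unfolding assoc_mult_mat_vec[OF Q m[OF g] v] assoc_mult_mat_vec[OF \<tau>c[OF g] Q v] .
  qed
  have "\<tau> \<in> hom G (GL d)"
  proof (rule hom_GL_I[OF \<tau>c])
    show "\<tau> \<one> = 1\<^sub>m d" unfolding \<tau>_def hom_GL_D(3)[OF \<sigma>] using S QS by simp
    fix x y assume x: "x \<in> carrier G" and y: "y \<in> carrier G"
    have yS: "\<sigma> y * S \<in> carrier_mat e d" by (rule mult_carrier_mat[OF m[OF y] S])
    have "\<tau> (x \<otimes> y) = Q * (\<sigma> x * (\<sigma> y * S))"
      unfolding \<tau>_def hom_GL_D(2)[OF \<sigma> x y] assoc_mult_mat[OF m[OF x] m[OF y] S] ..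
    also have "\<dots> = (Q * \<sigma> x) * (\<sigma> y * S)"
      by (rule assoc_mult_mat[symmetric, OF Q m[OF x] yS])
    also have "\<dots> = \<tau> x * (Q * (\<sigma> y * S))"
      unfolding comm[OF x] by (rule assoc_mult_mat[OF \<tau>c[OF x] Q yS])
    finally show "\<tau> (x \<otimes> y) = \<tau> x * \<tau> y" by (simp add: \<tau>_def)
  qed
  then show ?thesis using d Q S QS comm unfolding quotient_rep_def by blast
qed

text \<open>A nonzero quotient of smallest degree is irreducible, since an invariant subspace would give a
  smaller one.\<close>

lemma (in group) exists_irreducible_quotient_rep:
  assumes \<rho>: "\<rho> \<in> hom G (GL n)" and n: "n \<ge> 1"
  shows "\<exists>e \<sigma> P R. e \<le> n \<and> irreducible_rep G e \<sigma> \<and> quotient_rep G n \<rho> e \<sigma> P R"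
proof -
  define good where "good e \<longleftrightarrow> 1 \<le> e \<and> (\<exists>\<sigma> P R. quotient_rep G n \<rho> e \<sigma> P R)" for e
  have "1\<^sub>m n * \<rho> g = \<rho> g * 1\<^sub>m n" if "g \<in> carrier G" for g
    using hom_GL_D(1)[OF \<rho> that] by simp
  then have "quotient_rep G n \<rho> n \<rho> (1\<^sub>m n) (1\<^sub>m n)"
    using \<rho> by (simp add: quotient_rep_def)
  then have start: "good n" unfolding good_def using n by blast
  define e where "e = (LEAST e. good e)"
  have "good e" unfolding e_def using start by (rule LeastI)
  then obtain \<sigma> P R where e: "1 \<le> e" and q: "quotient_rep G n \<rho> e \<sigma> P R"
    unfolding good_def by blast
  have "e \<le> n" unfolding e_def using start by (rule Least_le)
  have \<sigma>: "\<sigma> \<in> hom G (GL e)" using q by (simp add: quotient_rep_def)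
  have "irreducible_rep G e \<sigma>"
    unfolding irreducible_rep_def
  proof (intro conjI allI impI \<sigma> e)
    fix W assume W: "VectorSpace.subspace class_ring W (module_vec TYPE(complex) e)
      \<and> (\<forall>g\<in>carrier G. \<forall>w\<in>W. \<sigma> g *\<^sub>v w \<in> W)"
    show "W = {0\<^sub>v e} \<or> W = carrier_vec e"
    proof (rule ccontr)
      assume "\<not> ?thesis"
      then obtain d \<tau> Q S where d: "1 \<le> d" "d < e" "quotient_rep G e \<sigma> d \<tau> Q S"
        using exists_quotient_rep_by_invariant_subspace[OF \<sigma>, of W] W by blast
      then have "good d" unfolding good_def using quotient_rep_trans[OF q d(3) \<rho>] by blast
      then have "e \<le> d" unfolding e_def by (rule Least_le)
      then show False using d by simp
    qed
  qed
  then show ?thesis using q \<open>e \<le> n\<close> by blast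
qed

section \<open>Counting irreducible representations by eigenvalues\<close>

lemma card_eigenvalues_le:
  fixes A :: "complex mat"
  assumes A: "A \<in> carrier_mat n n"
  shows "finite {k. eigenvalue A k}" "card {k. eigenvalue A k} \<le> n"
proof -
  have deg: "degree (char_poly A) = n" "coeff (char_poly A) n = 1"
    using degree_monic_char_poly[OF A] by auto
  then have nz: "char_poly A \<noteq> 0" by auto
  have roots: "{k. eigenvalue A k} = {k. poly (char_poly A) k = 0}"
    by (simp add: eigenvalue_root_char_poly[OF A])
  show "finite {k. eigenvalue A k}" unfolding roots by (rule poly_roots_finite[OF nz])
  show "card {k. eigenvalue A k} \<le> n"
    unfolding roots using card_poly_roots_bound[OF nz] deg by simp
qed

lemma eigenvalue_conjugate:
  fixes A B :: "complex mat"
  assumes A: "A \<in> carrier_mat d d" and B: "B \<in> carrier_mat d d" and P: "P \<in> carrier (GL d)"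
    and eq: "P * A = B * P" and ev: "eigenvalue A k"
  shows "eigenvalue B k"
proof -
  obtain v where v: "v \<in> carrier_vec d" "v \<noteq> 0\<^sub>v d" "A *\<^sub>v v = k \<cdot>\<^sub>v v"
    using ev A by (auto simp: eigenvalue_def eigenvector_def)
  obtain Q where PQ: "P \<in> carrier_mat d d" "Q \<in> carrier_mat d d" "Q * P = 1\<^sub>m d"
    using P by (auto simp: carrier_GL)
  have Pv: "P *\<^sub>v v \<in> carrier_vec d" by (rule mult_mat_vec_carrier[OF PQ(1) v(1)])
  have "B *\<^sub>v (P *\<^sub>v v) = (P * A) *\<^sub>v v"
    unfolding eq by (rule assoc_mult_mat_vec[symmetric, OF B PQ(1) v(1)])
  also have "\<dots> = P *\<^sub>v (A *\<^sub>v v)" by (rule assoc_mult_mat_vec[OF PQ(1) A v(1)])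
  also have "\<dots> = k \<cdot>\<^sub>v (P *\<^sub>v v)" unfolding v(3) by (rule mult_mat_vec[OF PQ(1) v(1)])
  finally have "B *\<^sub>v (P *\<^sub>v v) = k \<cdot>\<^sub>v (P *\<^sub>v v)" .
  moreover have "P *\<^sub>v v \<noteq> 0\<^sub>v d"
  proof
    assume 0: "P *\<^sub>v v = 0\<^sub>v d"
    have "v = (Q * P) *\<^sub>v v" unfolding PQ(3) using v(1) by simp
    also have "\<dots> = Q *\<^sub>v 0\<^sub>v d" unfolding assoc_mult_mat_vec[OF PQ(2,1) v(1)] 0 ..
    also have "\<dots> = 0\<^sub>v d" by (rule eq_vecI) (use PQ in auto)
    finally show False using v(2) by simp
  qed
  ultimately have "eigenvector B (P *\<^sub>v v) k"
    unfolding eigenvector_def using Pv B by simp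
  then show ?thesis unfolding eigenvalue_def by blast
qed

lemma card_le_mult_card_image:
  assumes "finite J" and fib: "\<And>y. y \<in> f ` J \<Longrightarrow> card {j \<in> J. f j = y} \<le> n"
  shows "card J \<le> n * card (f ` J)"
proof -
  have "J = (\<Union>y \<in> f ` J. {j \<in> J. f j = y})" by auto
  then have "card J \<le> (\<Sum>y \<in> f ` J. card {j \<in> J. f j = y})"
    using card_UN_le[of "f ` J" "\<lambda>y. {j \<in> J. f j = y}"] assms(1) by simp
  also have "\<dots> \<le> n * card (f ` J)"
    using sum_bounded_above[of "f ` J" "\<lambda>y. card {j \<in> J. f j = y}" n] fib by (simp add: mult.commute)
  finally show ?thesis .
qed

text \<open>Equivalent representations have the same eigenvalues at \<open>h\<close>, and a representation of degree at
  most \<open>n\<close> has at most \<open>n\<close> of them. So each class accounts for at most \<open>n\<close> of the values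
  \<open>\<mu> j\<close>.\<close>

lemma (in group) Rep_ge_of_eigenvalues:
  assumes J: "finite J" and irr: "\<And>j. j \<in> J \<Longrightarrow> (e j, \<sigma> j) \<in> finite_image_irreps n G"
    and h: "h \<in> carrier G" and ev: "\<And>j. j \<in> J \<Longrightarrow> eigenvalue (\<sigma> j h) (\<mu> j)"
    and inj: "inj_on \<mu> J" and card: "card J \<ge> n * N" and n: "n > 0"
  shows "enat N \<le> Rep n G"
proof (cases "finite (finite_image_irreps n G // rep_equivalence n G)")
  case False
  then show ?thesis by (simp add: Rep_def ecard_def)
next
  case True
  define c where "c j = rep_equivalence n G `` {(e j, \<sigma> j)}" for j
  have hom: "e j \<le> n" "\<sigma> j \<in> hom G (GL (e j))" if "j \<in> J" for j
    using irr[OF that] by (auto simp: finite_image_irreps_def irreducible_rep_def)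
  have "card {j \<in> J. c j = y} \<le> n" if y: "y \<in> c ` J" for y
  proof -
    obtain i where i: "i \<in> J" "y = c i" using y by blast
    note A = hom_GL_D(1)[OF hom(2)[OF i(1)] h]
    have "\<mu> j \<in> {k. eigenvalue (\<sigma> i h) k}" if j: "j \<in> J" "c j = y" for j
    proof -
      have "1\<^sub>m (e i) \<in> carrier (GL (e i))" by (auto simp: carrier_GL intro!: bexI[of _ "1\<^sub>m (e i)"])
      moreover have "1\<^sub>m (e i) * \<sigma> i g = \<sigma> i g * 1\<^sub>m (e i)" if "g \<in> carrier G" for g
        using hom_GL_D(1)[OF hom(2)[OF i(1)] that] by simp
      ultimately have "equivalent_rep G (e i) (\<sigma> i) (\<sigma> i)" unfolding equivalent_rep_def by blast
      then have "(e i, \<sigma> i) \<in> c i"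
        using irr[OF i(1)] by (simp add: c_def rep_equivalence_def)
      then have "(e i, \<sigma> i) \<in> c j" using i j by simp
      then have eq: "e j = e i" "equivalent_rep G (e i) (\<sigma> j) (\<sigma> i)"
        by (auto simp: c_def rep_equivalence_def)
      then obtain P where P: "P \<in> carrier (GL (e i))" "P * \<sigma> j h = \<sigma> i h * P"
        using h unfolding equivalent_rep_def by blast
      have "\<sigma> j h \<in> carrier_mat (e i) (e i)" using hom_GL_D(1)[OF hom(2)[OF j(1)] h] eq by simp
      then show ?thesis using eigenvalue_conjugate[OF _ A P ev[OF j(1)]] by simp
    qed
    then have "\<mu> ` {j \<in> J. c j = y} \<subseteq> {k. eigenvalue (\<sigma> i h) k}" by blast
    moreover have "inj_on \<mu> {j \<in> J. c j = y}" by (rule inj_on_subset[OF inj]) blast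
    ultimately have "card {j \<in> J. c j = y} \<le> card {k. eigenvalue (\<sigma> i h) k}"
      using card_inj_on_le card_eigenvalues_le(1)[OF A] by blast
    also have "\<dots> \<le> e i" by (rule card_eigenvalues_le(2)[OF A])
    finally show ?thesis using hom(1)[OF i(1)] by simp
  qed
  then have "card J \<le> n * card (c ` J)" by (rule card_le_mult_card_image[OF J])
  then have "n * N \<le> n * card (c ` J)" using card by (rule order_trans[rotated])
  then have "N \<le> card (c ` J)" using n by simp
  also have "c ` J \<subseteq> finite_image_irreps n G // rep_equivalence n G"
    unfolding c_def using irr by (auto intro: quotientI)
  then have "card (c ` J) \<le> card (finite_image_irreps n G // rep_equivalence n G)"
    by (rule card_mono[OF True])
  finally show ?thesis using True by (simp add: Rep_def ecard_def)
qed

text \<open>A cyclic vector \<open>v\<close> is not mapped to \<open>0\<close> in any nonzero quotient, so an eigenvector that is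
  cyclic hands its eigenvalue to every irreducible quotient.\<close>

lemma (in group) exists_irreducible_with_eigenvalue:
  assumes \<rho>: "\<rho> \<in> hom G (GL n)" and n: "n \<ge> 1" and fin: "finite (\<rho> ` carrier G)"
    and h: "h \<in> carrier G" and v: "v \<in> carrier_vec n" and ev: "\<rho> h *\<^sub>v v = k \<cdot>\<^sub>v v"
    and cyclic: "\<And>P e. P \<in> carrier_mat e n \<Longrightarrow> (\<And>g. g \<in> carrier G \<Longrightarrow> P *\<^sub>v (\<rho> g *\<^sub>v v) = 0\<^sub>v e)
        \<Longrightarrow> P = 0\<^sub>m e n"
  shows "\<exists>e \<sigma>. (e, \<sigma>) \<in> finite_image_irreps n G \<and> eigenvalue (\<sigma> h) k"
proof -
  obtain e \<sigma> P R where e: "e \<le> n" and irr: "irreducible_rep G e \<sigma>" and q: "quotient_rep G n \<rho> e \<sigma> P R"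
    using exists_irreducible_quotient_rep[OF \<rho> n] by blast
  have P: "P \<in> carrier_mat e n" "R \<in> carrier_mat n e" "P * R = 1\<^sub>m e" and \<sigma>: "\<sigma> \<in> hom G (GL e)"
    and comm: "\<And>g. g \<in> carrier G \<Longrightarrow> P * \<rho> g = \<sigma> g * P"
    using q by (auto simp: quotient_rep_def)
  note \<rho>c = hom_GL_D(1)[OF \<rho>] and \<sigma>c = hom_GL_D(1)[OF \<sigma>]
  have act: "P *\<^sub>v (\<rho> g *\<^sub>v v) = \<sigma> g *\<^sub>v (P *\<^sub>v v)" if g: "g \<in> carrier G" for g
    using assoc_mult_mat_vec[OF P(1) \<rho>c[OF g] v] assoc_mult_mat_vec[OF \<sigma>c[OF g] P(1) v] comm[OF g]
    by simp
  have Pv: "P *\<^sub>v v \<in> carrier_vec e" by (rule mult_mat_vec_carrier[OF P(1) v])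
  have "e \<ge> 1" using irr by (simp add: irreducible_rep_def)
  have "P *\<^sub>v v \<noteq> 0\<^sub>v e"
  proof
    assume 0: "P *\<^sub>v v = 0\<^sub>v e"
    have "P *\<^sub>v (\<rho> g *\<^sub>v v) = 0\<^sub>v e" if g: "g \<in> carrier G" for g
      unfolding act[OF g] 0 by (rule eq_vecI) (use \<sigma>c[OF g] in auto)
    then have "P = 0\<^sub>m e n" by (rule cyclic[OF P(1)])
    then have "(1\<^sub>m e :: complex mat) = 0\<^sub>m e e" using P by simp
    then have "(1\<^sub>m e :: complex mat) $$ (0, 0) = 0\<^sub>m e e $$ (0, 0)" by simp
    then show False using \<open>e \<ge> 1\<close> by simp
  qed
  moreover have "\<sigma> h *\<^sub>v (P *\<^sub>v v) = k \<cdot>\<^sub>v (P *\<^sub>v v)"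
    unfolding act[OF h, symmetric] ev by (rule mult_mat_vec[OF P(1) v])
  ultimately have "eigenvector (\<sigma> h) (P *\<^sub>v v) k"
    using Pv \<sigma>c[OF h] by (simp add: eigenvector_def)
  then have "eigenvalue (\<sigma> h) k" unfolding eigenvalue_def by blast
  moreover have "\<sigma> g = (P * \<rho> g) * R" if g: "g \<in> carrier G" for g
    unfolding comm[OF g] assoc_mult_mat[OF \<sigma>c[OF g] P(1,2)] P(3) using \<sigma>c[OF g] by simp
  then have "\<sigma> ` carrier G \<subseteq> (\<lambda>A. (P * A) * R) ` \<rho> ` carrier G" by auto
  then have "finite (\<sigma> ` carrier G)" using fin finite_surj by blast
  ultimately show ?thesis using e irr by (auto simp: finite_image_irreps_def)
qed

section \<open>Monomial representations from voltages\<close>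

definition root_of_unity :: "int \<Rightarrow> int \<Rightarrow> complex" where
  "root_of_unity m a = cis (2 * pi * (of_int a / of_int m))"

lemma root_of_unity_add: "root_of_unity m (a + b) = root_of_unity m a * root_of_unity m b"
  by (simp add: root_of_unity_def cis_mult add_divide_distrib distrib_left)

lemma root_of_unity_0 [simp]: "root_of_unity m 0 = 1"
  by (simp add: root_of_unity_def)

lemma root_of_unity_nonzero [simp]: "root_of_unity m a \<noteq> 0"
  by (simp add: root_of_unity_def)

lemma root_of_unity_eq_1_iff:
  assumes m: "m > 0"
  shows "root_of_unity m a = 1 \<longleftrightarrow> m dvd a"
proof
  assume "m dvd a"
  then obtain k where "a = m * k" by blast
  then show "root_of_unity m a = 1" using m by (simp add: root_of_unity_def cis_multiple_2pi)
next
  assume "root_of_unity m a = 1"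
  then have "cos (2 * pi * (of_int a / of_int m)) = 1"
    by (simp add: root_of_unity_def complex_eq_iff)
  then obtain k :: int where "2 * pi * (of_int a / of_int m) = of_int k * 2 * pi"
    unfolding cos_one_2pi_int by blast
  then have "2 * pi * (of_int a :: real) = 2 * pi * (of_int k * of_int m)"
    using m by (simp add: field_simps)
  then have "(of_int a :: real) = of_int (k * m)"
    by simp
  then show "m dvd a" unfolding of_int_eq_iff by simp
qed

lemma root_of_unity_eq_iff:
  assumes m: "m > 0"
  shows "root_of_unity m a = root_of_unity m b \<longleftrightarrow> m dvd a - b"
proof -
  have "root_of_unity m a = root_of_unity m (a - b) * root_of_unity m b"
    by (simp flip: root_of_unity_add)
  then show ?thesis using root_of_unity_eq_1_iff[OF m, of "a - b"] by simp
qed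

text \<open>For a character \<open>\<zeta>\<close> of \<open>\<int>/m\<close>, the voltage \<open>\<alpha>\<close> followed by \<open>\<zeta>\<close> is a character of the kernel of
  \<open>E\<close>, and the matrices \<open>vmat w\<close> below form the representation induced from it: \<open>w\<close> moves the
  vertex \<open>r x\<close> to \<open>r x @ w\<close> and contributes the voltage of that path. With right
  multiplication on the vertices, row index before column index makes \<open>vmat\<close> multiplicative.\<close>

locale voltage_representation = group_congruence E for E :: "('a list \<times> 'a list) set" +
  fixes \<alpha> :: "'a list \<Rightarrow> 'a \<Rightarrow> int" and n :: nat and r :: "nat \<Rightarrow> 'a list"
    and m :: int and \<zeta> :: "int \<Rightarrow> complex"
  assumes voltage: "voltage_on E \<alpha>"
    and transversal: "\<exists>x<n. (w, r x) \<in> E"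
    and transversal_unique: "x < n \<Longrightarrow> y < n \<Longrightarrow> (r x, r y) \<in> E \<Longrightarrow> x = y"
    and \<zeta>_add: "\<zeta> (a + b) = \<zeta> a * \<zeta> b"
    and \<zeta>_0: "\<zeta> 0 = 1"
    and \<zeta>_periodic: "m dvd a - b \<Longrightarrow> \<zeta> a = \<zeta> b"
begin

lemma \<zeta>_nonzero: "\<zeta> a \<noteq> 0"
  using \<zeta>_add[of a "- a"] \<zeta>_0 by auto

definition vmat :: "'a list \<Rightarrow> complex mat" where
  "vmat w = mat n n (\<lambda>(x, y). if (r x @ w, r y) \<in> E then \<zeta> (net_voltage \<alpha> (r x) w) else 0)"

lemma vmat_carrier [simp]: "vmat w \<in> carrier_mat n n"
  by (simp add: vmat_def)

lemma vmat_index: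
  assumes "x < n" "y < n"
  shows "vmat w $$ (x, y) = (if (r x @ w, r y) \<in> E then \<zeta> (net_voltage \<alpha> (r x) w) else 0)"
  using assms by (simp add: vmat_def)

lemma vmat_Nil: "vmat [] = 1\<^sub>m n"
  by (rule eq_matI) (auto simp: vmat_index \<zeta>_0 transversal_unique vmat_carrier[THEN carrier_matD(1)]
      vmat_carrier[THEN carrier_matD(2)])

lemma vmat_append: "vmat (u @ v) = vmat u * vmat v"
proof (rule eq_matI)
  fix x y assume "x < dim_row (vmat u * vmat v)" "y < dim_col (vmat u * vmat v)"
  then have xy: "x < n" "y < n" by (simp_all add: vmat_def)
  obtain z where z: "z < n" "(r x @ u, r z) \<in> E" using transversal by blast
  have zu: "(r x @ u, r k) \<in> E \<longleftrightarrow> k = z" if "k < n" for k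
  proof
    assume "(r x @ u, r k) \<in> E"
    then have "(r k, r z) \<in> E" by (rule trans[OF sym z(2)])
    then show "k = z" by (rule transversal_unique[OF that z(1)])
  qed (use z in simp)
  have "(vmat u * vmat v) $$ (x, y) = (\<Sum>k = 0..<n. vmat u $$ (x, k) * vmat v $$ (k, y))"
    using xy by (simp add: vmat_def scalar_prod_def)
  also have "\<dots> = (\<Sum>k = 0..<n. if k = z then \<zeta> (net_voltage \<alpha> (r x) u) * vmat v $$ (z, y) else 0)"
    by (intro sum.cong HOL.refl) (use xy zu in \<open>auto simp: vmat_index\<close>)
  also have "\<dots> = \<zeta> (net_voltage \<alpha> (r x) u) * vmat v $$ (z, y)" using z(1) by simp
  also have "\<dots> = vmat (u @ v) $$ (x, y)"
  proof -
    have "(r z @ v, r y) \<in> E \<longleftrightarrow> (r x @ u @ v, r y) \<in> E"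
      using append_right[OF z(2), of v] trans sym by (metis append_assoc)
    moreover have "net_voltage \<alpha> (r z) v = net_voltage \<alpha> (r x @ u) v"
      by (rule net_voltage_cong[OF voltage sym[OF z(2)]])
    ultimately show ?thesis
      using xy z(1) by (simp add: vmat_index net_voltage_append \<zeta>_add)
  qed
  finally show "vmat (u @ v) $$ (x, y) = (vmat u * vmat v) $$ (x, y)" by (rule HOL.sym)
qed (simp_all add: vmat_def)

lemma vmat_cong:
  assumes uv: "(u, v) \<in> voltage_cover E \<alpha> m"
  shows "vmat u = vmat v"
proof -
  have "(r x @ u, r y) \<in> E \<longleftrightarrow> (r x @ v, r y) \<in> E" for x y
    using append_left[of u v "r x"] uv trans sym unfolding voltage_cover_def by blast
  moreover have "\<zeta> (net_voltage \<alpha> x u) = \<zeta> (net_voltage \<alpha> x v)" for x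
    by (rule \<zeta>_periodic) (use uv in \<open>simp add: voltage_cover_def\<close>)
  ultimately show ?thesis by (intro eq_matI) (simp_all add: vmat_def)
qed

text \<open>For \<open>x = y\<close> and \<open>w\<close> in the kernel this exhibits an eigenvector; for general \<open>x\<close> it shows that
  the basis vectors are permuted transitively up to scalars, so that each of them is cyclic.\<close>

lemma vmat_unit_vec:
  assumes x: "x < n" and y: "y < n" and xy: "(r x @ w, r y) \<in> E"
  shows "vmat w *\<^sub>v unit_vec n y = \<zeta> (net_voltage \<alpha> (r x) w) \<cdot>\<^sub>v unit_vec n x"
proof (rule eq_vecI)
  fix k assume "k < dim_vec (\<zeta> (net_voltage \<alpha> (r x) w) \<cdot>\<^sub>v unit_vec n x)"
  then have k: "k < n" by simp
  have only: "k = x" if "(r k @ w, r y) \<in> E"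
  proof (rule transversal_unique[OF k x])
    obtain v where v: "(w @ v, []) \<in> E" using inverse_exists by blast
    have "(r k @ w, r x @ w) \<in> E" using that sym[OF xy] by (rule trans)
    then have *: "(r k @ w @ v, r x @ w @ v) \<in> E" using append_right by fastforce
    have "(z @ w @ v, z) \<in> E" for z using v by (simp add: append_trivial_iff)
    from trans[OF sym[OF this] trans[OF * this]] show "(r k, r x) \<in> E" .
  qed
  have "(vmat w *\<^sub>v unit_vec n y) $ k = vmat w $$ (k, y)"
    using k y by (simp add: vmat_def)
  also have "\<dots> = (\<zeta> (net_voltage \<alpha> (r x) w) \<cdot>\<^sub>v unit_vec n x) $ k"
  proof (cases "k = x")
    case True
    then show ?thesis using x xy y by (simp add: vmat_index)
  next
    case False
    then have "(r k @ w, r y) \<notin> E" using only by blast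
    then show ?thesis using False k x by (simp add: vmat_index[OF k y])
  qed
  finally show "(vmat w *\<^sub>v unit_vec n y) $ k = (\<zeta> (net_voltage \<alpha> (r x) w) \<cdot>\<^sub>v unit_vec n x) $ k" .
qed (simp add: vmat_def)

lemma unit_vec_cyclic:
  assumes y: "y < n" and P: "P \<in> carrier_mat e n"
    and zero: "\<And>w. P *\<^sub>v (vmat w *\<^sub>v unit_vec n y) = 0\<^sub>v e"
  shows "P = 0\<^sub>m e n"
proof (rule eq_matI)
  fix i x assume "i < dim_row (0\<^sub>m e n)" "x < dim_col (0\<^sub>m e n)"
  then have ix: "i < e" "x < n" by simp_all
  obtain v where v: "(r x @ v, []) \<in> E" using inverse_exists by blast
  have "(r x @ v @ r y, r y) \<in> E" using append_right[OF v, of "r y"] by simp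
  then have "vmat (v @ r y) *\<^sub>v unit_vec n y = \<zeta> (net_voltage \<alpha> (r x) (v @ r y)) \<cdot>\<^sub>v unit_vec n x"
    by (rule vmat_unit_vec[OF ix(2) y])
  then have "\<zeta> (net_voltage \<alpha> (r x) (v @ r y)) \<cdot>\<^sub>v (P *\<^sub>v unit_vec n x) = 0\<^sub>v e"
    using zero[of "v @ r y"] mult_mat_vec[OF P unit_vec_carrier] by simp
  then have "(\<zeta> (net_voltage \<alpha> (r x) (v @ r y)) \<cdot>\<^sub>v (P *\<^sub>v unit_vec n x)) $ i = 0" using ix by simp
  then show "P $$ (i, x) = 0\<^sub>m e n $$ (i, x)" using ix P \<zeta>_nonzero by simp
qed (use P in auto)

end

section \<open>The group of a periodic congruence\<close>

text \<open>Each class of words is represented by the least code of its members, which puts the quotient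
  group on a set of natural numbers.\<close>

definition word_code :: "('a::countable list \<times> 'a list) set \<Rightarrow> 'a list \<Rightarrow> nat" where
  "word_code E w = (LEAST k. (w, from_nat k) \<in> E)"

definition word_group :: "('a::countable list \<times> 'a list) set \<Rightarrow> nat monoid" where
  "word_group E = \<lparr>carrier = range (word_code E),
     monoid.mult = (\<lambda>a b. word_code E (from_nat a @ from_nat b)), one = word_code E []\<rparr>"

locale countable_group_congruence = group_congruence E
  for E :: "('a::countable list \<times> 'a list) set"
begin

abbreviation "\<pi> \<equiv> word_code E"
abbreviation "G \<equiv> word_group E"

lemma from_nat_code: "(w, from_nat (\<pi> w)) \<in> E"
  unfolding word_code_def by (rule LeastI[of _ "to_nat w"]) simp

lemma code_eq_iff: "\<pi> u = \<pi> v \<longleftrightarrow> (u, v) \<in> E"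
proof
  assume "\<pi> u = \<pi> v"
  then have "(u, from_nat (\<pi> v)) \<in> E" using from_nat_code[of u] by simp
  then show "(u, v) \<in> E" by (rule trans[OF _ sym[OF from_nat_code]])
next
  assume "(u, v) \<in> E"
  then have "(u, w) \<in> E \<longleftrightarrow> (v, w) \<in> E" for w using trans sym by blast
  then show "\<pi> u = \<pi> v" by (simp add: word_code_def)
qed

lemma carrier_G: "carrier G = range \<pi>"
  and one_G: "\<one>\<^bsub>G\<^esub> = \<pi> []"
  by (simp_all add: word_group_def)

lemma mult_G: "\<pi> u \<otimes>\<^bsub>G\<^esub> \<pi> v = \<pi> (u @ v)"
  unfolding word_group_def using append[OF from_nat_code from_nat_code] sym
  by (simp add: code_eq_iff)

lemma group_G: "group G"
proof (rule groupI)
  show "\<exists>y\<in>carrier G. y \<otimes>\<^bsub>G\<^esub> x = \<one>\<^bsub>G\<^esub>" if x: "x \<in> carrier G" for x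
  proof -
    obtain w where w: "x = \<pi> w" using x by (auto simp: carrier_G)
    obtain v where "(v @ w, []) \<in> E" using inverse_exists by blast
    then have "\<pi> v \<otimes>\<^bsub>G\<^esub> x = \<one>\<^bsub>G\<^esub>" by (simp add: w mult_G one_G code_eq_iff)
    then show ?thesis by (auto simp: carrier_G)
  qed
qed (auto simp: carrier_G mult_G one_G)

sublocale group G by (rule group_G)

lemma pow_G: "\<pi> w [^]\<^bsub>G\<^esub> k = \<pi> (wpow w k)"
  by (induction k) (simp_all add: one_G mult_G wpow_Suc')

lemma torsion_G:
  assumes "g \<in> carrier G"
  shows "\<exists>q>0. g [^]\<^bsub>G\<^esub> (q::nat) = \<one>\<^bsub>G\<^esub>"
  using assms periodic by (auto simp: carrier_G pow_G one_G code_eq_iff)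

lemma finitely_generated_G:
  assumes "finite (UNIV :: 'a set)"
  shows "finitely_generated G"
proof -
  let ?S = "range (\<lambda>a. \<pi> [a])"
  have "\<pi> w \<in> generate G ?S" for w
  proof (induction w)
    case Nil
    then show ?case using generate.one[of G ?S] by (simp add: one_G)
  next
    case (Cons a w)
    have "\<pi> [a] \<otimes>\<^bsub>G\<^esub> \<pi> w \<in> generate G ?S"
      by (rule generate.eng[OF generate.incl Cons]) simp
    then show ?case by (simp add: mult_G)
  qed
  moreover have S: "?S \<subseteq> carrier G" by (auto simp: carrier_G)
  ultimately have "generate G ?S = carrier G"
    using generate_incl[OF S] by (auto simp: carrier_G)
  then show ?thesis using S assms unfolding finitely_generated_def by blast
qed

text \<open>The normal subgroup of the word group that a coarser congruence \<open>F\<close> defines; its index is the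
  number of classes of \<open>F\<close>.\<close>

definition kernel_of :: "('a list \<times> 'a list) set \<Rightarrow> nat set" where
  "kernel_of F = {\<pi> w | w. (w, []) \<in> F}"

lemma kernel_of_iff:
  assumes F: "group_congruence F" "E \<subseteq> F"
  shows "\<pi> w \<in> kernel_of F \<longleftrightarrow> (w, []) \<in> F"
proof
  interpret F: group_congruence F by fact
  assume "\<pi> w \<in> kernel_of F"
  then obtain v where v: "\<pi> w = \<pi> v" "(v, []) \<in> F" by (auto simp: kernel_of_def)
  then have "(w, v) \<in> F" using F(2) by (auto simp: code_eq_iff)
  then show "(w, []) \<in> F" using v(2) by (rule F.trans)
qed (auto simp: kernel_of_def)

lemma normal_kernel_of:
  assumes F: "group_congruence F" "E \<subseteq> F"
  shows "kernel_of F \<lhd> G"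
proof (rule normal_invI)
  interpret F: group_congruence F by fact
  note [simp] = kernel_of_iff[OF F]
  have inv: "\<exists>v. inv\<^bsub>G\<^esub> (\<pi> w) = \<pi> v \<and> (w @ v, []) \<in> F \<and> (v @ w, []) \<in> F" for w
  proof -
    obtain v where v: "(w @ v, []) \<in> E" "(v @ w, []) \<in> E" using inverse_exists by blast
    then have "\<pi> v \<otimes>\<^bsub>G\<^esub> \<pi> w = \<one>\<^bsub>G\<^esub>" by (simp add: mult_G one_G code_eq_iff)
    then have "inv\<^bsub>G\<^esub> (\<pi> w) = \<pi> v" by (rule inv_equality) (auto simp: carrier_G)
    then show ?thesis using v F(2) by blast
  qed
  show "subgroup (kernel_of F) G"
  proof (rule subgroupI)
    show "kernel_of F \<subseteq> carrier G" by (auto simp: kernel_of_def carrier_G)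
    have "\<pi> [] \<in> kernel_of F" by simp
    then show "kernel_of F \<noteq> {}" by blast
    show "inv\<^bsub>G\<^esub> a \<in> kernel_of F" if a: "a \<in> kernel_of F" for a
    proof -
      obtain w where w: "a = \<pi> w" "(w, []) \<in> F" using a by (auto simp: kernel_of_def)
      obtain v where v: "inv\<^bsub>G\<^esub> (\<pi> w) = \<pi> v" "(v @ w, []) \<in> F" using inv by blast
      have "(v @ w, v) \<in> F" using w(2) by (simp add: F.append_trivial_iff)
      then have "(v, []) \<in> F" using F.trans[OF F.sym v(2)] by blast
      then show ?thesis using v(1) w(1) by simp
    qed
    show "a \<otimes>\<^bsub>G\<^esub> b \<in> kernel_of F" if ab: "a \<in> kernel_of F" "b \<in> kernel_of F" for a b
    proof -
      obtain u v where uv: "a = \<pi> u" "(u, []) \<in> F" "b = \<pi> v" "(v, []) \<in> F"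
        using ab unfolding kernel_of_def by blast
      then have "(u @ v, []) \<in> F" using F.append[OF uv(2,4)] by simp
      then show ?thesis by (simp add: uv mult_G)
    qed
  qed
  show "x \<otimes>\<^bsub>G\<^esub> h \<otimes>\<^bsub>G\<^esub> inv\<^bsub>G\<^esub> x \<in> kernel_of F" if x: "x \<in> carrier G" and h: "h \<in> kernel_of F" for x h
  proof -
    obtain u w where uw: "x = \<pi> u" "h = \<pi> w" "(w, []) \<in> F"
      using x h unfolding kernel_of_def carrier_G by blast
    obtain v where v: "inv\<^bsub>G\<^esub> (\<pi> u) = \<pi> v" "(u @ v, []) \<in> F" using inv by blast
    have "(u @ w @ v, u @ v) \<in> F" using F.append_left[OF F.append_right[OF uw(3), of v], of u] by simp
    then have "(u @ w @ v, []) \<in> F" using v(2) by (rule F.trans)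
    then show ?thesis using uw v(1) by (simp add: mult_G)
  qed
qed

lemma index_kernel_of:
  assumes F: "finite_group_congruence F" "E \<subseteq> F"
  shows "finite (rcosets\<^bsub>G\<^esub> (kernel_of F))" "card (rcosets\<^bsub>G\<^esub> (kernel_of F)) \<le> card (UNIV // F)"
proof -
  interpret F: finite_group_congruence F by fact
  note F' = F.group_congruence_axioms F(2)
  interpret N: normal "kernel_of F" G by (rule normal_kernel_of[OF F'])
  define c where "c X = kernel_of F #>\<^bsub>G\<^esub> \<pi> (SOME x. x \<in> X)" for X
  have c: "kernel_of F #>\<^bsub>G\<^esub> \<pi> w = c (F `` {w})" for w
  proof -
    let ?v = "SOME x. x \<in> F `` {w}"
    have "?v \<in> F `` {w}" by (rule someI[of _ w]) simp
    then have wv: "(?v, w) \<in> F" using F.sym by blast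
    obtain u where u: "(u @ w, []) \<in> E" "(w @ u, []) \<in> E" using inverse_exists by blast
    have "(?v @ u, w @ u) \<in> F" by (rule F.append_right[OF wv])
    then have "(?v @ u, []) \<in> F" using F.trans F(2) u(2) by blast
    then have "\<pi> (?v @ u) \<in> kernel_of F" by (simp add: kernel_of_iff[OF F'])
    then have "\<pi> (?v @ u) \<otimes>\<^bsub>G\<^esub> \<pi> w \<in> kernel_of F #>\<^bsub>G\<^esub> \<pi> w"
      by (rule rcosI[OF _ N.subset]) (simp add: carrier_G)
    also have "\<pi> (?v @ u) \<otimes>\<^bsub>G\<^esub> \<pi> w = \<pi> ?v"
      using u(1) by (simp add: mult_G code_eq_iff append_trivial_iff)
    finally have "\<pi> ?v \<in> kernel_of F #>\<^bsub>G\<^esub> \<pi> w" .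
    then show ?thesis unfolding c_def
      by (rule repr_independence) (simp_all add: carrier_G N.subgroup_axioms)
  qed
  have "rcosets\<^bsub>G\<^esub> (kernel_of F) \<subseteq> c ` (UNIV // F)"
    unfolding RCOSETS_def carrier_G using c by (auto intro: quotientI)
  then show "finite (rcosets\<^bsub>G\<^esub> (kernel_of F))" "card (rcosets\<^bsub>G\<^esub> (kernel_of F)) \<le> card (UNIV // F)"
    using F.finite_quotient by (auto intro: finite_surj surj_card_le)
qed

text \<open>An element that survives in the intersection of congruences already survives in one of them.\<close>

lemma residually_finite_G:
  assumes fgc: "\<And>k::nat. finite_group_congruence (F k)" and E: "E = (\<Inter>k. F k)"
  shows "residually_finite G"
  unfolding residually_finite_def
proof (intro ballI impI)
  fix g assume "g \<in> carrier G" and ne: "g \<noteq> \<one>\<^bsub>G\<^esub>"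
  then obtain w where w: "g = \<pi> w" by (auto simp: carrier_G)
  then have "(w, []) \<notin> E" using ne by (simp add: one_G code_eq_iff)
  then obtain k where k: "(w, []) \<notin> F k" by (auto simp: E)
  have F: "group_congruence (F k)" "E \<subseteq> F k"
    using fgc[of k] by (auto simp: E finite_group_congruence_def)
  have "kernel_of (F k) \<lhd> G" by (rule normal_kernel_of[OF F])
  moreover have "finite_index (kernel_of (F k)) G"
    unfolding finite_index_def using index_kernel_of(1)[OF fgc F(2)] calculation
    by (simp add: normal_def)
  moreover have "g \<notin> kernel_of (F k)" using k by (simp add: w kernel_of_iff[OF F])
  ultimately show "\<exists>N. N \<lhd> G \<and> finite_index N G \<and> g \<notin> N" by blast
qed

text \<open>The character \<open>\<theta>\<close> takes \<open>M\<close> values on the powers of \<open>h\<close>, which bounds the abelianization of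
  the kernel \<open>?N\<close> of index \<open>n\<close>. The \<open>j\<close>-th power of \<open>\<theta>\<close> takes at \<open>h\<close> the value of \<open>\<theta>\<close> at the
  \<open>j\<close>-th power of \<open>h\<close>, so the representations induced from these powers have \<open>M\<close> different
  eigenvalues at \<open>h\<close>.\<close>

lemma ab_and_Rep_ge:
  assumes F: "finite_group_congruence F" and cyc: "cyclic_quotient F F' M" and E: "E \<subseteq> F'"
    and n: "n = card (UNIV // F)" and M: "M \<ge> n * N"
  shows "enat M \<le> ab n G" "enat N \<le> Rep n G"
proof -
  interpret F: finite_group_congruence F by fact
  obtain \<alpha> h m where \<alpha>: "voltage_on F \<alpha>" and m: "m > 0" and h: "(h, []) \<in> F"
    and F': "F' \<subseteq> voltage_cover F \<alpha> m"
    and inj: "inj_on (\<lambda>j. net_voltage \<alpha> [] (wpow h j) mod m) {..<M}"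
    using cyc unfolding cyclic_quotient_def by blast
  have EC: "E \<subseteq> voltage_cover F \<alpha> m" using E F' by blast
  then have EF: "E \<subseteq> F" by (auto simp: voltage_cover_def)
  note Fc = F.group_congruence_axioms
  note roots = root_of_unity_eq_iff[OF m]
  let ?v = "net_voltage \<alpha> []"
  define \<theta> where "\<theta> g = root_of_unity m (?v (from_nat g))" for g
  have \<theta>: "\<theta> (\<pi> w) = root_of_unity m (?v w)" for w
    unfolding \<theta>_def roots using EC from_nat_code sym by (auto simp: voltage_cover_def)
  have injr: "inj_on (\<lambda>j. root_of_unity m (?v (wpow h j))) {..<M}"
    using inj unfolding inj_on_def roots mod_eq_dvd_iff .
  let ?N = "kernel_of F"
  have sub: "subgroup ?N G" using normal_kernel_of[OF Fc EF] by (simp add: normal_def)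
  have hN: "\<pi> (wpow h j) \<in> ?N" for j
    using F.wpow_trivial[OF h] by (simp add: kernel_of_iff[OF Fc EF])
  let ?X = "(\<lambda>j. \<theta> (\<pi> (wpow h j))) ` {..<M}"
  have "card ?X = M" using injr by (simp add: \<theta> card_image)
  then have "enat M = ecard ?X" by (simp add: ecard_def)
  also have "\<dots> \<le> ab n G"
  proof (rule ab_ge_of_character[OF sub])
    show "ecard (rcosets\<^bsub>G\<^esub> ?N) \<le> enat n"
      using index_kernel_of[OF F EF] by (simp add: ecard_def n)
    show "\<theta> (x \<otimes>\<^bsub>G\<^esub> y) = \<theta> x * \<theta> y" if xy: "x \<in> ?N" "y \<in> ?N" for x y
    proof -
      obtain u v where uv: "x = \<pi> u" "(u, []) \<in> F" "y = \<pi> v" using xy unfolding kernel_of_def by blast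
      then show ?thesis
        by (simp add: mult_G \<theta> F.net_voltage_append_trivial[OF \<alpha> uv(2)] root_of_unity_add)
    qed
    show "\<theta> x \<noteq> 0" for x by (simp add: \<theta>_def)
    show "?X \<subseteq> \<theta> ` ?N" using hN by blast
  qed
  finally show "enat M \<le> ab n G" .

  have "F `` {[]} \<in> UNIV // F" by (simp add: quotientI)
  then have n0: "n > 0" using F.finite_quotient by (auto simp: n card_gt_0_iff)
  obtain b where b: "bij_betw b {0..<n} (UNIV // F)"
    using ex_bij_betw_nat_finite[OF F.finite_quotient] n by blast
  define r where "r x = (SOME w. w \<in> b x)" for x
  have br: "b x = F `` {r x}" if x: "x < n" for x
  proof -
    have "b x \<in> UNIV // F" using b x by (auto simp: bij_betw_def)
    then obtain w where w: "b x = F `` {w}" by (rule quotientE)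
    have "w \<in> b x" unfolding w by simp
    then have "r x \<in> b x" unfolding r_def by (rule someI)
    then show ?thesis unfolding w by (simp add: F.class_eq_iff)
  qed
  have tr: "\<exists>x<n. (w, r x) \<in> F" for w
  proof -
    have "F `` {w} \<in> b ` {0..<n}" using b by (simp add: bij_betw_def quotientI)
    then obtain x where x: "x < n" "F `` {w} = b x" by auto
    then show ?thesis using br[of x] F.class_eq_iff[of w "r x"] by auto
  qed
  have tr_unique: "x = y" if "x < n" "y < n" "(r x, r y) \<in> F" for x y
  proof -
    have "b x = b y" using that br F.class_eq_iff by simp
    then show ?thesis using b that by (auto simp: bij_betw_def inj_on_def)
  qed
  obtain y where y: "y < n" "([], r y) \<in> F" using tr by blast
  have "\<exists>e \<sigma>. (e, \<sigma>) \<in> finite_image_irreps n G \<and> eigenvalue (\<sigma> (\<pi> h)) (root_of_unity m (?v (wpow h j)))"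
    for j
  proof -
    interpret V: voltage_representation F \<alpha> n r m "\<lambda>a. root_of_unity m (int j * a)"
    proof unfold_locales
      fix a b :: int assume "m dvd a - b"
      then have "m dvd int j * a - int j * b" by (simp flip: right_diff_distrib)
      then show "root_of_unity m (int j * a) = root_of_unity m (int j * b)" by (simp add: roots)
    qed (use \<alpha> tr tr_unique in \<open>auto simp: distrib_left root_of_unity_add\<close>)
    define \<rho> where "\<rho> g = V.vmat (from_nat g)" for g
    have \<rho>: "\<rho> (\<pi> w) = V.vmat w" for w
      unfolding \<rho>_def by (rule V.vmat_cong) (use EC from_nat_code sym in blast)
    have hom: "\<rho> \<in> hom G (GL n)"
      by (rule hom_GL_I) (auto simp: carrier_G mult_G one_G \<rho> V.vmat_append V.vmat_Nil)
    interpret C: finite_group_congruence "voltage_cover F \<alpha> m"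
      by (rule F.finite_group_congruence_voltage_cover[OF \<alpha> m])
    have "V.vmat w = V.vmat (SOME u. u \<in> voltage_cover F \<alpha> m `` {w})" for w
    proof (rule V.vmat_cong)
      have "(SOME u. u \<in> voltage_cover F \<alpha> m `` {w}) \<in> voltage_cover F \<alpha> m `` {w}"
        by (rule someI[of _ w]) simp
      then show "(w, SOME u. u \<in> voltage_cover F \<alpha> m `` {w}) \<in> voltage_cover F \<alpha> m" by blast
    qed
    then have "range V.vmat \<subseteq> (\<lambda>X. V.vmat (SOME u. u \<in> X)) ` (UNIV // voltage_cover F \<alpha> m)"
      by (auto intro!: image_eqI quotientI)
    then have "finite (range V.vmat)" using C.finite_quotient finite_surj by blast
    then have fin: "finite (\<rho> ` carrier G)" by (rule finite_subset[rotated]) (auto simp: \<rho>_def)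
    have yh: "(r y @ h, r y) \<in> F" using h by (simp add: F.append_trivial_iff)
    have "net_voltage \<alpha> (r y) h = ?v h" by (rule F.net_voltage_cong[OF \<alpha> F.sym[OF y(2)]])
    then have ev: "\<rho> (\<pi> h) *\<^sub>v unit_vec n y = root_of_unity m (?v (wpow h j)) \<cdot>\<^sub>v unit_vec n y"
      using V.vmat_unit_vec[OF y(1) y(1) yh] by (simp add: \<rho> F.net_voltage_wpow[OF \<alpha> h])
    show ?thesis
    proof (rule exists_irreducible_with_eigenvalue[OF hom _ fin _ _ ev])
      fix P e assume P: "P \<in> carrier_mat e n"
        "\<And>g. g \<in> carrier G \<Longrightarrow> P *\<^sub>v (\<rho> g *\<^sub>v unit_vec n y) = 0\<^sub>v e"
      have "P *\<^sub>v (V.vmat w *\<^sub>v unit_vec n y) = 0\<^sub>v e" for w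
        using P(2)[of "\<pi> w"] by (simp add: carrier_G \<rho>)
      then show "P = 0\<^sub>m e n" by (rule V.unit_vec_cyclic[OF y(1) P(1)])
    qed (use n0 in \<open>auto simp: carrier_G\<close>)
  qed
  then obtain e \<sigma> where e\<sigma>: "\<And>j. (e j, \<sigma> j) \<in> finite_image_irreps n G"
    "\<And>j. eigenvalue (\<sigma> j (\<pi> h)) (root_of_unity m (?v (wpow h j)))"
    by metis
  show "enat N \<le> Rep n G"
    by (rule Rep_ge_of_eigenvalues[OF _ e\<sigma>(1) _ e\<sigma>(2) injr]) (use M n0 in \<open>auto simp: carrier_G\<close>)
qed

end

section \<open>Groups with FAb and arbitrarily fast growth\<close>

text \<open>Each irreducible representation of degree at most \<open>n\<close> may absorb \<open>n\<close> characters, so the chain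
  is built for the function \<open>n * f n\<close>; one group then serves for both kinds of growth.\<close>

lemma exists_FAb_group_with_fast_growth:
  fixes f :: "nat \<Rightarrow> nat"
  shows "\<exists>G :: nat monoid. group G \<and> finitely_generated G \<and> residually_finite G \<and> FAb G
    \<and> infinite {n. n \<ge> 1 \<and> enat (f n) \<le> ab n G \<and> enat (f n) \<le> Rep n G}"
proof -
  obtain F :: "nat \<Rightarrow> (bool list \<times> bool list) set"
    where fgc: "\<And>k. finite_group_congruence (F k)" and dec: "\<And>k. F (Suc k) \<subseteq> F k"
      and card: "\<And>k. card (UNIV // F k) < card (UNIV // F (Suc k))"
      and cyc: "\<And>k. cyclic_quotient (F k) (F (Suc k))
        (card (UNIV // F k) * f (card (UNIV // F k)) + 2)"
      and per: "\<And>w. \<exists>q>0. \<forall>k. (wpow w q, []) \<in> F k"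
    using exists_periodic_chain[of "\<lambda>n. n * f n"] by blast
  define E where "E = (\<Inter>k. F k)"
  have gc: "group_congruence (F k)" for k using fgc[of k] by (simp add: finite_group_congruence_def)
  interpret countable_group_congruence E
  proof
    show "equiv UNIV E"
    proof (rule equivI)
      show "refl E" unfolding E_def refl_on_def using group_congruence.refl[OF gc] by auto
      show "sym E" unfolding E_def by (rule symI) (use group_congruence.sym[OF gc] in auto)
      show "trans E"
      proof (rule transI)
        fix u v w assume "(u, v) \<in> E" "(v, w) \<in> E"
        then show "(u, w) \<in> E"
          using group_congruence.trans[OF gc, of u v _ w] by (simp add: E_def)
      qed
    qed simp
    show "(u @ v, u' @ v') \<in> E" if "(u, u') \<in> E" "(v, v') \<in> E" for u u' v v'
      using that group_congruence.append[OF gc, of u u' _ v v'] by (simp add: E_def)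
    show "\<exists>k>0. (wpow w k, []) \<in> E" for w using per[of w] by (auto simp: E_def)
  qed
  define idx where "idx k = card (UNIV // F k)" for k
  have "strict_mono idx" using card by (simp add: strict_mono_Suc_iff idx_def)
  have large: "enat (f (idx k)) \<le> ab (idx k) G \<and> enat (f (idx k)) \<le> Rep (idx k) G" if "idx k \<ge> 1" for k
  proof -
    have EF: "E \<subseteq> F (Suc k)" by (auto simp: E_def)
    let ?M = "idx k * f (idx k) + 2"
    have "enat (f (idx k)) \<le> enat ?M" using that by (cases "idx k") auto
    also have "enat ?M \<le> ab (idx k) G"
      by (rule ab_and_Rep_ge(1)[OF fgc cyc[folded idx_def] EF idx_def, of 0]) simp
    finally show ?thesis
      using ab_and_Rep_ge(2)[OF fgc cyc[folded idx_def] EF idx_def, of "f (idx k)"] by simp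
  qed
  have "idx (Suc k) \<ge> 1" for k
    using strict_monoD[OF \<open>strict_mono idx\<close>, of k "Suc k"] by simp
  then have "range (\<lambda>k. idx (Suc k)) \<subseteq> {n. n \<ge> 1 \<and> enat (f n) \<le> ab n G \<and> enat (f n) \<le> Rep n G}"
    using large by blast
  moreover have "inj (\<lambda>k. idx (Suc k))"
    using strict_mono_eq[OF \<open>strict_mono idx\<close>] by (auto simp: inj_on_def)
  then have "infinite (range (\<lambda>k. idx (Suc k)))" by (simp add: finite_image_iff)
  ultimately have "infinite {n. n \<ge> 1 \<and> enat (f n) \<le> ab n G \<and> enat (f n) \<le> Rep n G}"
    using finite_subset by blast
  moreover have "finitely_generated G" by (rule finitely_generated_G) simp
  moreover have "FAb G" by (rule FAb_of_finitely_generated_torsion[OF calculation(2) torsion_G])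
  moreover have "residually_finite G" by (rule residually_finite_G[OF fgc E_def])
  ultimately show ?thesis using group_G by blast
qed

theorem proposition23:
  shows
    "(\<forall>f :: nat \<Rightarrow> nat. f \<in> {1..} \<rightarrow> {1..} \<longrightarrow>
       (\<exists>G :: nat monoid. group G \<and> finitely_generated G \<and> residually_finite G \<and> FAb G \<and>
          infinite {n. n \<ge> 1 \<and> ab n G \<ge> enat (f n)})) \<and>
     (\<forall>f :: nat \<Rightarrow> nat. f \<in> {1..} \<rightarrow> {1..} \<longrightarrow>
       (\<exists>G :: nat monoid. group G \<and> finitely_generated G \<and> residually_finite G \<and> FAb G \<and>
          infinite {n. n \<ge> 1 \<and> Rep n G \<ge> enat (f n)}))"
proof -
  have "\<exists>G :: nat monoid. group G \<and> finitely_generated G \<and> residually_finite G \<and> FAb G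
      \<and> infinite {n. n \<ge> 1 \<and> ab n G \<ge> enat (f n)} \<and> infinite {n. n \<ge> 1 \<and> Rep n G \<ge> enat (f n)}"
    for f :: "nat \<Rightarrow> nat"
  proof -
    obtain G :: "nat monoid" where G: "group G" "finitely_generated G" "residually_finite G" "FAb G"
      and inf: "infinite {n. n \<ge> 1 \<and> enat (f n) \<le> ab n G \<and> enat (f n) \<le> Rep n G}"
      using exists_FAb_group_with_fast_growth by blast
    have "infinite {n. n \<ge> 1 \<and> ab n G \<ge> enat (f n)}" "infinite {n. n \<ge> 1 \<and> Rep n G \<ge> enat (f n)}"
      by (rule infinite_super[OF _ inf], blast)+
    then show ?thesis using G by blast
  qed
  then show ?thesis by meson
qed

end
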